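(* Let $A$ be an $n\times n$ nonsingular, block strongly nonsingular matrix with a blocking of $n_t$ blocks and largest block size $n_b$, and let $A=LR$ be a block LU factorization (computed by the block LU algorithm in exact arithmetic) in which every diagonal block $L_{kk}$ is unitary. Let $\|\cdot\|_p$ be a Schatten $p$-norm, $1\le p\le\infty$ (with $n_b^{1/p}=1$ for $p=\infty$, the spectral norm). Then $$\|L\|_p\le n_b^{1/p}n_t+n_t\rho_p\kappa_p(A),\qquad \|R\|_p\le n_t\rho_p\|A\|_p,$$ and hence $\|L\|_p\|R\|_p\le n_t^2\rho_p^2\kappa_p(A)\|A\|_p+n_b^{1/p}n_t^2\rho_p\|A\|_p$. The analogous result holds if instead the diagonal blocks of $R$ are unitary.
   Context: Blocking: a strictly increasing list $[1=\mathcal{I}_1<\dots<\mathcal{I}_{n_t+1}=n+1]$ defining blocks $A_{i,j}$ (rows $\mathcal{I}_i:\mathcal{I}_{i+1}-1$, columns $\mathcal{I}_j:\mathcal{I}_{j+1}-1$). Block strongly nonsingular: each leading block principal submatrix $A_{1:k,1:k}$ is nonsingular. Block LU algorithm: $A^{(1)}=A$; for $k=1,\dots,n_t$, factor $A^{(k)}_{kk}=L_{kk}R_{kk}$ (any factorization into nonsingular factors), set $L_{k+1:n_t,k}=A^{(k)}_{k+1:n_t,k}R_{kk}^{-1}$, $R_{k,k+1:n_t}=L_{kk}^{-1}A^{(k)}_{k,k+1:n_t}$, and $A^{(k+1)}=A^{(k)}_{k+1:n_t,k+1:n_t}-L_{k+1:n_t,k}R_{k,k+1:n_t}$; $L$ is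 block lower triangular and $R$ block upper triangular. Block growth factor $\rho_p=\max_{1\le k\le n_t}\|A^{(k)}\|_p/\|A\|_p$. $\kappa_p(A)=\|A\|_p\|A^{-1}\|_p$. *)

theory Defs
  imports "Jordan_Normal_Form.Schur_Decomposition"
          "Jordan_Normal_Form.Gauss_Jordan_Elimination"
          "Jordan_Normal_Form.Char_Poly"
          "HOL-Library.Extended_Real"
begin

(* Matrices are Jordan_Normal_Form complex matrices; indices are 0-based.
   A blocking of an n x n matrix is a list I with I!0 = 0 < I!1 < ... < I!nt = n;
   block k (0-based, k < nt) consists of the indices I!k ..< I!(k+1). *)

definition valid_blocking :: "nat list \<Rightarrow> nat \<Rightarrow> bool" where
  "valid_blocking I n \<longleftrightarrow> length I \<ge> 1 \<and> sorted_wrt (<) I \<and> I ! 0 = 0 \<and> I ! (length I - 1) = n"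

abbreviation nblocks :: "nat list \<Rightarrow> nat" where
  "nblocks I \<equiv> length I - 1"

definition max_block_size :: "nat list \<Rightarrow> nat" where
  "max_block_size I = Max {I ! Suc k - I ! k | k. k < nblocks I}"

definition blk_sub :: "'a mat \<Rightarrow> nat \<Rightarrow> nat \<Rightarrow> nat \<Rightarrow> nat \<Rightarrow> 'a mat" where
  "blk_sub A r0 r1 c0 c1 = mat (r1 - r0) (c1 - c0) (\<lambda>(i, j). A $$ (r0 + i, c0 + j))"

definition block :: "nat list \<Rightarrow> 'a mat \<Rightarrow> nat \<Rightarrow> nat \<Rightarrow> 'a mat" where
  "block I A k l = blk_sub A (I ! k) (I ! Suc k) (I ! l) (I ! Suc l)"

definition block_strongly_nonsingular :: "nat list \<Rightarrow> complex mat \<Rightarrow> bool" where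
  "block_strongly_nonsingular I A \<longleftrightarrow>
     (\<forall>k \<in> {1..nblocks I}. invertible_mat (blk_sub A 0 (I ! k) 0 (I ! k)))"

definition block_lower :: "nat list \<Rightarrow> 'a::zero mat \<Rightarrow> bool" where
  "block_lower I L \<longleftrightarrow> (\<forall>k l i j. k < nblocks I \<and> l < nblocks I \<and> k < l \<and>
      I ! k \<le> i \<and> i < I ! Suc k \<and> I ! l \<le> j \<and> j < I ! Suc l \<longrightarrow> L $$ (i, j) = 0)"

definition block_upper :: "nat list \<Rightarrow> 'a::zero mat \<Rightarrow> bool" where
  "block_upper I R \<longleftrightarrow> (\<forall>k l i j. k < nblocks I \<and> l < nblocks I \<and> l < k \<and>
      I ! k \<le> i \<and> i < I ! Suc k \<and> I ! l \<le> j \<and> j < I ! Suc l \<longrightarrow> R $$ (i, j) = 0)"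

definition minv :: "complex mat \<Rightarrow> complex mat" where
  "minv A = the (mat_inverse A)"

definition unitary_mat :: "complex mat \<Rightarrow> bool" where
  "unitary_mat U \<longleftrightarrow> U \<in> carrier_mat (dim_row U) (dim_row U) \<and>
     U * mat_adjoint U = 1\<^sub>m (dim_row U) \<and> mat_adjoint U * U = 1\<^sub>m (dim_row U)"

(* One run of the block LU algorithm (exact arithmetic).  Ak k is A^(k+1) of the paper
   (0-based step k), a square matrix of size n - I!k whose first block has size
   I!(k+1) - I!k.  The factorization of the pivot block is arbitrary, with nonsingular
   factors, and the resulting factors L, R are block lower / upper triangular. *)
definition block_lu_run :: "nat list \<Rightarrow> complex mat \<Rightarrow> (nat \<Rightarrow> complex mat)
      \<Rightarrow> complex mat \<Rightarrow> complex mat \<Rightarrow> bool" where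
  "block_lu_run I A Ak L R \<longleftrightarrow>
     (let n = dim_row A in
       L \<in> carrier_mat n n \<and> R \<in> carrier_mat n n \<and>
       block_lower I L \<and> block_upper I R \<and> Ak 0 = A \<and>
       (\<forall>k < nblocks I.
          let a = I ! k; b = I ! Suc k; s = n - a; m = b - a;
              Lkk = blk_sub L a b a b; Rkk = blk_sub R a b a b;
              Lcol = blk_sub L b n a b; Rrow = blk_sub R a b b n in
          invertible_mat Lkk \<and> invertible_mat Rkk \<and>
          blk_sub (Ak k) 0 m 0 m = Lkk * Rkk \<and>
          Lcol = blk_sub (Ak k) m s 0 m * minv Rkk \<and>
          Rrow = minv Lkk * blk_sub (Ak k) 0 m m s \<and>
          Ak (Suc k) = blk_sub (Ak k) m s m s - Lcol * Rrow))"

definition sing_vals :: "complex mat \<Rightarrow> real multiset" where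
  "sing_vals A = image_mset (\<lambda>z. sqrt (Re z)) (proots (char_poly (mat_adjoint A * A)))"

definition schatten :: "ereal \<Rightarrow> complex mat \<Rightarrow> real" where
  "schatten p A = (if p = \<infinity> then Max (insert 0 (set_mset (sing_vals A)))
      else (\<Sum>\<^sub># (image_mset (\<lambda>s. s powr real_of_ereal p) (sing_vals A))) powr (1 / real_of_ereal p))"

definition root_p :: "ereal \<Rightarrow> real \<Rightarrow> real" where
  "root_p p x = (if p = \<infinity> then 1 else x powr (1 / real_of_ereal p))"

definition kappa :: "ereal \<Rightarrow> complex mat \<Rightarrow> real" where
  "kappa p A = schatten p A * schatten p (minv A)"

definition growth :: "ereal \<Rightarrow> nat list \<Rightarrow> complex mat \<Rightarrow> (nat \<Rightarrow> complex mat) \<Rightarrow> real" where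
  "growth p I A Ak = Max {schatten p (Ak k) / schatten p A | k. k < nblocks I}"

end

theory Submission
  imports Defs "HOL-Analysis.Convex"
begin

text \<open>
  The Schatten norm of a matrix is the largest lp norm of the diagonal of \<open>P A Q\<close> over all
  contractions \<open>P\<close> and \<open>Q\<close>. This variational formula makes it a submultiplicative norm that
  decreases under multiplication by contractions, in particular under passing to submatrices.

  With \<open>T\<^sub>k\<close> the projection onto the indices from block \<open>k\<close> on and \<open>P\<^sub>k = T\<^sub>k - T\<^sub>k\<^sub>+\<^sub>1\<close>, the matrix
  \<open>A\<^sup>(\<^sup>k\<^sup>)\<close> padded with zeros is \<open>L T\<^sub>k R\<close>. If the diagonal blocks of \<open>L\<close>
  are unitary, \<open>D\<^sub>k = P\<^sub>k L P\<^sub>k\<close> is a partial isometry with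
  \<open>P\<^sub>k R = D\<^sub>k\<^sup>* L T\<^sub>k R\<close>, which bounds each block row of \<open>R\<close> by the norm of \<open>A\<^sup>(\<^sup>k\<^sup>)\<close>. Since the inverse of
  \<open>L\<close> is block lower triangular too, the part of block column \<open>k\<close> of \<open>L\<close> below the diagonal is
  \<open>- (L T\<^sub>k\<^sub>+\<^sub>1 R) A\<^sup>-\<^sup>1 D\<^sub>k\<close>, which is bounded by the norm of \<open>A\<^sup>(\<^sup>k\<^sup>+\<^sup>1\<^sup>)\<close> times that of \<open>A\<^sup>-\<^sup>1\<close>.
  The case of unitary diagonal blocks of \<open>R\<close> follows by taking adjoints.
\<close>

section \<open>Finite lp norms\<close>

text \<open>Follows the two branches of \<open>schatten\<close>, so that both agree when
  \<open>f\<close> enumerates the singular values. There are no absolute values because only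
  nonnegative \<open>f\<close> are meant, and \<open>insert 0\<close> makes the maximum meaningful
  for \<open>n = 0\<close>.\<close>

definition lp_norm :: "ereal \<Rightarrow> nat \<Rightarrow> (nat \<Rightarrow> real) \<Rightarrow> real" where
  "lp_norm p n f = (if p = \<infinity> then Max (insert 0 (f ` {..<n}))
     else (\<Sum>i<n. f i powr real_of_ereal p) powr (1 / real_of_ereal p))"

lemma lp_norm_infinity: "lp_norm \<infinity> n f = Max (insert 0 (f ` {..<n}))"
  by (simp add: lp_norm_def)

lemma lp_norm_ereal: "lp_norm (ereal r) n f = (\<Sum>i<n. f i powr r) powr (1 / r)"
  by (simp add: lp_norm_def)

lemma one_le_ereal_cases:
  assumes "1 \<le> (p::ereal)"
  obtains "p = \<infinity>" | r where "p = ereal r" "1 \<le> r"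
  using assms by (cases p) (auto simp: one_ereal_def)

lemma lp_norm_nonneg: "0 \<le> lp_norm p n f"
  by (simp add: lp_norm_def)

lemma lp_norm_infinity_le:
  assumes "\<And>i. i < n \<Longrightarrow> f i \<le> c" "0 \<le> c"
  shows "lp_norm \<infinity> n f \<le> c"
  using assms by (auto simp: lp_norm_infinity)

lemma lp_norm_infinity_ge: "i < n \<Longrightarrow> f i \<le> lp_norm \<infinity> n f"
  by (auto simp: lp_norm_infinity intro!: Max_ge)

lemma lp_norm_mono:
  assumes "1 \<le> p" and "\<And>i. i < n \<Longrightarrow> 0 \<le> f i" and "\<And>i. i < n \<Longrightarrow> f i \<le> g i"
  shows "lp_norm p n f \<le> lp_norm p n g"
  using assms(1)
proof (cases rule: one_le_ereal_cases)
  case 1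
  show ?thesis unfolding 1
    by (rule lp_norm_infinity_le) (auto intro: order_trans[OF assms(3) lp_norm_infinity_ge] lp_norm_nonneg)
next
  case (2 r)
  show ?thesis unfolding 2 lp_norm_ereal using 2(2) assms(2,3)
    by (intro powr_mono2 sum_mono sum_nonneg) auto
qed

lemma lp_norm_cong: "(\<And>i. i < n \<Longrightarrow> f i = g i) \<Longrightarrow> lp_norm p n f = lp_norm p n g"
  by (auto simp: lp_norm_def intro!: arg_cong[where f=Max] arg_cong[where f="insert 0"] image_cong
      arg_cong[where f="\<lambda>x. x powr (1 / real_of_ereal p)"])

lemma lp_norm_component:
  assumes "1 \<le> p" and "i < n" and f: "\<And>i. i < n \<Longrightarrow> 0 \<le> f i"
  shows "f i \<le> lp_norm p n f"
  using assms(1)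
proof (cases rule: one_le_ereal_cases)
  case 1
  then show ?thesis using assms lp_norm_infinity_ge by simp
next
  case (2 r)
  have "f i powr r \<le> (\<Sum>i<n. f i powr r)"
    using assms by (intro member_le_sum) auto
  then have "(f i powr r) powr (1 / r) \<le> (\<Sum>i<n. f i powr r) powr (1 / r)"
    using 2(2) by (intro powr_mono2) auto
  then show ?thesis using 2 assms by (simp add: powr_powr lp_norm_ereal)
qed

lemma lp_norm_one: "1 \<le> p \<Longrightarrow> 0 \<le> f 0 \<Longrightarrow> lp_norm p 1 f = f 0"
  by (erule one_le_ereal_cases) (auto simp: lp_norm_infinity lp_norm_ereal powr_powr lessThan_Suc)

lemma lp_norm_scale:
  assumes "1 \<le> p" and "0 \<le> c" and "\<And>i. i < n \<Longrightarrow> 0 \<le> f i"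
  shows "lp_norm p n (\<lambda>i. c * f i) \<le> c * lp_norm p n f"
  using assms(1)
proof (cases rule: one_le_ereal_cases)
  case 1
  show ?thesis unfolding 1
    by (rule lp_norm_infinity_le) (auto intro: mult_left_mono lp_norm_infinity_ge mult_nonneg_nonneg lp_norm_nonneg assms)
next
  case (2 r)
  have "(\<Sum>i<n. (c * f i) powr r) = c powr r * (\<Sum>i<n. f i powr r)"
    using assms by (simp add: powr_mult sum_distrib_left)
  then show ?thesis unfolding 2 lp_norm_ereal using 2(2) assms
    by (simp add: powr_mult powr_powr sum_nonneg)
qed

text \<open>Extends convexity from positive numbers to the endpoint 0. If one of the two points is
  0, the inequality reduces to \<open>t powr r\<close> being at most \<open>t\<close> for
  \<open>t\<close> between 0 and 1.\<close>

lemma powr_convex_nonneg: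
  assumes "1 \<le> r"
  shows "convex_on {0..} (\<lambda>x::real. x powr r)"
proof (rule convex_onI)
  have aux: "(t * z) powr r \<le> t * z powr r" if "0 < t" "t < 1" "0 \<le> z" for t z :: real
  proof -
    have "t powr r \<le> t powr 1" using that assms by (intro powr_mono') auto
    then show ?thesis using that by (simp add: powr_mult mult_right_mono)
  qed
  fix t x y :: real assume t: "0 < t" "t < 1" and x: "x \<in> {0..}" and y: "y \<in> {0..}"
  consider "x = 0" | "y = 0" | "0 < x" "0 < y" using x y by force
  then show "((1 - t) *\<^sub>R x + t *\<^sub>R y) powr r \<le> (1 - t) * x powr r + t * y powr r"
  proof cases
    case 3
    then show ?thesis using t by (intro convex_onD[OF powr_convex[OF assms]]) auto
  qed (use t x y aux[of t y] aux[of "1 - t" x] assms in auto)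
qed simp

text \<open>Jensen's inequality for weights whose sum may fall short of one: the missing mass is put
  on an extra index \<open>n\<close> at the point 0, where the power vanishes.\<close>

lemma powr_weighted_sum_le:
  fixes w s :: "nat \<Rightarrow> real"
  assumes "1 \<le> r" and "\<And>j. j < n \<Longrightarrow> 0 \<le> w j" and "\<And>j. j < n \<Longrightarrow> 0 \<le> s j"
    and "(\<Sum>j<n. w j) \<le> 1"
  shows "(\<Sum>j<n. w j * s j) powr r \<le> (\<Sum>j<n. w j * s j powr r)"
proof -
  define a where "a j = (if j < n then w j else 1 - (\<Sum>j<n. w j))" for j
  define y where "y j = (if j < n then s j else 0)" for j
  have "(\<Sum>j\<in>{..n}. a j *\<^sub>R y j) powr r \<le> (\<Sum>j\<in>{..n}. a j * y j powr r)"
  proof (rule convex_on_sum[OF _ _ powr_convex_nonneg[OF assms(1)]])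
    show "(\<Sum>i\<le>n. a i) = 1" by (simp add: lessThan_Suc_atMost[symmetric] a_def)
  qed (use assms in \<open>auto simp: a_def y_def\<close>)
  moreover have "(\<Sum>j\<in>{..n}. a j *\<^sub>R y j) = (\<Sum>j<n. w j * s j)"
    by (simp add: lessThan_Suc_atMost[symmetric] a_def y_def)
  moreover have "(\<Sum>j\<in>{..n}. a j * y j powr r) = (\<Sum>j<n. w j * s j powr r)"
    using assms(1) by (simp add: lessThan_Suc_atMost[symmetric] a_def y_def)
  ultimately show ?thesis by simp
qed

text \<open>Doubly substochastic matrices shrink every lp norm. For infinite \<open>p\<close> the
  row sums suffice; for finite \<open>p\<close> Jensen's inequality is applied in each row, and the
  column sums bound the result after the sums are swapped.\<close>

lemma lp_norm_substochastic:
  assumes p: "1 \<le> p" and w: "\<And>i j. i < m \<Longrightarrow> j < n \<Longrightarrow> 0 \<le> w i j" and s: "\<And>j. j < n \<Longrightarrow> 0 \<le> s j"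
    and row: "\<And>i. i < m \<Longrightarrow> (\<Sum>j<n. w i j) \<le> 1" and col: "\<And>j. j < n \<Longrightarrow> (\<Sum>i<m. w i j) \<le> 1"
  shows "lp_norm p m (\<lambda>i. \<Sum>j<n. w i j * s j) \<le> lp_norm p n s"
  using p
proof (cases rule: one_le_ereal_cases)
  case 1
  let ?N = "lp_norm \<infinity> n s"
  show ?thesis unfolding 1
  proof (rule lp_norm_infinity_le)
    fix i assume i: "i < m"
    have "(\<Sum>j<n. w i j * s j) \<le> (\<Sum>j<n. w i j * ?N)"
      using i w by (intro sum_mono mult_left_mono lp_norm_infinity_ge) auto
    also have "\<dots> = (\<Sum>j<n. w i j) * ?N" by (simp add: sum_distrib_right)
    also have "\<dots> \<le> 1 * ?N" by (intro mult_right_mono row i lp_norm_nonneg)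
    finally show "(\<Sum>j<n. w i j * s j) \<le> ?N" by simp
  qed (rule lp_norm_nonneg)
next
  case (2 r)
  have "(\<Sum>i<m. (\<Sum>j<n. w i j * s j) powr r) \<le> (\<Sum>i<m. \<Sum>j<n. w i j * s j powr r)"
    using 2(2) w s row by (intro sum_mono powr_weighted_sum_le) auto
  also have "\<dots> = (\<Sum>j<n. (\<Sum>i<m. w i j) * s j powr r)"
    by (subst sum.swap) (simp add: sum_distrib_right)
  also have "\<dots> \<le> (\<Sum>j<n. 1 * s j powr r)"
    by (intro sum_mono mult_right_mono col) auto
  finally show ?thesis unfolding 2 lp_norm_ereal using 2(2)
    by (intro powr_mono2 sum_nonneg) auto
qed

text \<open>Minkowski's inequality by normalisation: with \<open>a\<close> and \<open>b\<close> the
  norms of \<open>f\<close> and \<open>g\<close>, the sum \<open>f + g\<close> is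
  \<open>a + b\<close> times a convex combination of \<open>f / a\<close> and \<open>g / b\<close>,
  to which convexity of the power applies pointwise. A vanishing norm is treated separately.\<close>

lemma lp_norm_triangle:
  assumes p: "1 \<le> p" and f: "\<And>i. i < n \<Longrightarrow> 0 \<le> f i" and g: "\<And>i. i < n \<Longrightarrow> 0 \<le> g i"
  shows "lp_norm p n (\<lambda>i. f i + g i) \<le> lp_norm p n f + lp_norm p n g"
  using p
proof (cases rule: one_le_ereal_cases)
  case 1
  show ?thesis unfolding 1
    by (rule lp_norm_infinity_le)
      (auto intro: add_mono lp_norm_infinity_ge add_nonneg_nonneg lp_norm_nonneg)
next
  case (2 r)
  define a where "a = lp_norm (ereal r) n f"
  define b where "b = lp_norm (ereal r) n g"
  have nonneg: "0 \<le> a" "0 \<le> b" by (auto simp: a_def b_def lp_norm_nonneg)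
  have ar: "(\<Sum>i<n. f i powr r) = a powr r" and br: "(\<Sum>i<n. g i powr r) = b powr r"
    using 2(2) by (auto simp: a_def b_def lp_norm_ereal powr_powr sum_nonneg)
  show ?thesis
  proof (cases "a = 0 \<or> b = 0")
    case True
    have zero: "h i = 0" if "(\<Sum>i<n. h i powr r) = 0" "i < n" for h :: "nat \<Rightarrow> real" and i
      using that by (subst (asm) sum_nonneg_eq_0_iff) auto
    from True show ?thesis
    proof
      assume "a = 0"
      then have "(\<Sum>i<n. f i powr r) = 0" using ar by simp
      from zero[OF this] have "lp_norm p n (\<lambda>i. f i + g i) = lp_norm p n g"
        by (intro lp_norm_cong) auto
      then show ?thesis by (simp add: lp_norm_nonneg)
    next
      assume "b = 0"
      then have "(\<Sum>i<n. g i powr r) = 0" using br by simp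
      from zero[OF this] have "lp_norm p n (\<lambda>i. f i + g i) = lp_norm p n f"
        by (intro lp_norm_cong) auto
      then show ?thesis by (simp add: lp_norm_nonneg)
    qed
  next
    case False
    then have pos: "0 < a" "0 < b" using nonneg by auto
    \<comment> \<open>This weight is forced by
      \<open>(f i + g i) / (a + b) = (1 - t) * (f i / a) + t * (g i / b)\<close>.\<close>
    define t where "t = b / (a + b)"
    have t: "0 \<le> t" "t \<le> 1" "1 - t = a / (a + b)"
      using pos by (auto simp: t_def field_simps)
    have "(f i + g i) powr r \<le> (a + b) powr r * ((1 - t) * (f i powr r / a powr r) + t * (g i powr r / b powr r))"
      if i: "i < n" for i
    proof -
      have "((1 - t) *\<^sub>R (f i / a) + t *\<^sub>R (g i / b)) powr r \<le> (1 - t) * (f i / a) powr r + t * (g i / b) powr r"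
        using pos t i f g by (intro convex_onD[OF powr_convex_nonneg[OF 2(2)]]) auto
      moreover have "(1 - t) *\<^sub>R (f i / a) + t *\<^sub>R (g i / b) = (f i + g i) / (a + b)"
        using pos unfolding t(3) by (simp add: t_def add_divide_distrib)
      ultimately show ?thesis using pos i f[of i] g[of i]
        by (simp add: powr_divide pos_divide_le_eq mult.commute)
    qed
    then have "(\<Sum>i<n. (f i + g i) powr r) \<le> (\<Sum>i<n. (a + b) powr r * ((1 - t) * (f i powr r / a powr r) + t * (g i powr r / b powr r)))"
      by (intro sum_mono) auto
    also have "\<dots> = (a + b) powr r * ((1 - t) * ((\<Sum>i<n. f i powr r) / a powr r) + t * ((\<Sum>i<n. g i powr r) / b powr r))"
      by (simp add: sum_distrib_left sum.distrib sum_divide_distrib distrib_left)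
    also have "\<dots> = (a + b) powr r"
      using pos by (simp add: ar br)
    finally have "(\<Sum>i<n. (f i + g i) powr r) powr (1 / r) \<le> ((a + b) powr r) powr (1 / r)"
      using 2(2) by (intro powr_mono2 sum_nonneg) auto
    also have "\<dots> = a + b" using 2(2) pos by (simp add: powr_powr)
    finally show ?thesis unfolding 2 by (simp add: lp_norm_ereal a_def b_def)
  qed
qed

lemma lp_norm_indicator:
  assumes "1 \<le> p" and "a < b" and "b \<le> n"
  shows "lp_norm p n (\<lambda>i. if a \<le> i \<and> i < b then 1 else 0) \<le> root_p p (real (b - a))"
  using assms(1)
proof (cases rule: one_le_ereal_cases)
  case 1
  then show ?thesis unfolding 1 root_p_def
    by simp (rule lp_norm_infinity_le, auto)
next
  case (2 r)
  have "(\<Sum>i<n. (if a \<le> i \<and> i < b then 1 else 0) powr r) = (\<Sum>i<n. if i \<in> {a..<b} then 1 else (0::real))"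
    using 2(2) by (intro sum.cong) auto
  also have "\<dots> = real (b - a)"
    using assms(3) by (subst sum.inter_filter[symmetric])
      (auto simp: Collect_conj_eq[symmetric] intro!: arg_cong[where f=card, of _ "{a..<b}", simplified])
  finally show ?thesis unfolding 2 lp_norm_ereal root_p_def by simp
qed

section \<open>Contractions\<close>

lemma adjoint_dim [simp]:
  "dim_row (mat_adjoint A) = dim_col A" "dim_col (mat_adjoint A) = dim_row A"
  by (auto simp: mat_adjoint_def)

lemma adjoint_carrier [simp, intro]: "A \<in> carrier_mat m n \<Longrightarrow> mat_adjoint A \<in> carrier_mat n m"
  by (intro carrier_matI) auto

lemma adjoint_index [simp]:
  "i < dim_col A \<Longrightarrow> j < dim_row A \<Longrightarrow> mat_adjoint A $$ (i, j) = cnj (A $$ (j, i))"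
  by (auto simp: mat_adjoint_def mat_of_rows_def conjugate_vec_def)

lemma adjoint_adjoint [simp]: "mat_adjoint (mat_adjoint (A :: complex mat)) = A"
  by (rule eq_matI) auto

lemma mult_mat_index:
  assumes "A \<in> carrier_mat m n" "B \<in> carrier_mat n r" "i < m" "j < r"
  shows "(A * B) $$ (i, j) = (\<Sum>k<n. A $$ (i, k) * B $$ (k, j))"
  using assms by (auto simp: scalar_prod_def atLeast0LessThan intro!: sum.cong)

declare index_mult_mat(1) [simp del]

lemma adjoint_mult:
  fixes A B :: "complex mat"
  assumes "A \<in> carrier_mat m n" "B \<in> carrier_mat n r"
  shows "mat_adjoint (A * B) = mat_adjoint B * mat_adjoint A"
proof (rule eq_matI)
  fix i j assume "i < dim_row (mat_adjoint B * mat_adjoint A)" "j < dim_col (mat_adjoint B * mat_adjoint A)"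
  then have ij: "i < r" "j < m" using assms by auto
  have "mat_adjoint (A * B) $$ (i, j) = cnj ((A * B) $$ (j, i))" using ij assms by simp
  also have "\<dots> = (\<Sum>k<n. mat_adjoint B $$ (i, k) * mat_adjoint A $$ (k, j))"
    using ij assms by (subst mult_mat_index[OF assms ij(2,1)]) (auto intro!: sum.cong)
  also have "\<dots> = (mat_adjoint B * mat_adjoint A) $$ (i, j)"
    using ij assms by (subst mult_mat_index[of _ r n _ m]) auto
  finally show "mat_adjoint (A * B) $$ (i, j) = (mat_adjoint B * mat_adjoint A) $$ (i, j)" .
qed (use assms in auto)

definition dmat :: "nat \<Rightarrow> (nat \<Rightarrow> 'a::zero) \<Rightarrow> 'a mat" where
  "dmat n d = mat n n (\<lambda>(i, j). if i = j then d i else 0)"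

lemma dmat_carrier [simp, intro]: "dmat n d \<in> carrier_mat n n"
  by (simp add: dmat_def)

lemma dmat_dim [simp]: "dim_row (dmat n d) = n" "dim_col (dmat n d) = n"
  by (simp_all add: dmat_def)

lemma dmat_index [simp]: "i < n \<Longrightarrow> j < n \<Longrightarrow> dmat n d $$ (i, j) = (if i = j then d i else 0)"
  by (simp add: dmat_def)

lemma mult_dmat_index [simp]:
  assumes "dim_col A = n" "i < dim_row A" "j < n"
  shows "(A * dmat n d) $$ (i, j) = A $$ (i, j) * (d j :: 'a::semiring_1)"
  using assms by (subst mult_mat_index[of _ "dim_row A" n _ n]) (auto simp: if_distrib cong: if_cong)

lemma dmat_mult_index [simp]:
  assumes "dim_row A = n" "i < n" "j < dim_col A"
  shows "(dmat n d * A) $$ (i, j) = (d i :: 'a::semiring_1) * A $$ (i, j)"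
  using assms by (subst mult_mat_index[of _ n n _ "dim_col A"]) (auto simp: if_distrib[of "\<lambda>x. x * _"] cong: if_cong)

lemma dmat_mult_dmat: "dmat n d * dmat n e = dmat n (\<lambda>i. d i * (e i :: 'a::semiring_1))"
  by (rule eq_matI) auto

lemma dmat_cong: "(\<And>i. i < n \<Longrightarrow> d i = e i) \<Longrightarrow> dmat n d = dmat n e"
  by (rule eq_matI) auto

lemma adjoint_dmat: "mat_adjoint (dmat n d) = dmat n (\<lambda>i. cnj (d i))"
  by (rule eq_matI) auto

lemma dmat_one: "dmat n (\<lambda>_. 1) = 1\<^sub>m n"
  by (rule eq_matI) auto

section \<open>Squared Euclidean length and contractions\<close>

definition sqn :: "complex vec \<Rightarrow> real" where
  "sqn v = (\<Sum>i<dim_vec v. (cmod (v $ i))\<^sup>2)"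

lemma sqn_nonneg: "0 \<le> sqn v"
  by (auto simp: sqn_def intro: sum_nonneg)

lemma of_real_sqn: "complex_of_real (sqn v) = v \<bullet>c v"
  by (simp add: sqn_def scalar_prod_def atLeast0LessThan complex_norm_square del: of_real_power)

lemma cscalar_prod_cauchy_schwarz:
  fixes v w :: "complex vec"
  assumes "v \<in> carrier_vec n" "w \<in> carrier_vec n"
  shows "(cmod (v \<bullet>c w))\<^sup>2 \<le> sqn v * sqn w"
proof -
  have "cmod (v \<bullet>c w) \<le> (\<Sum>i<n. cmod (v $ i) * cmod (w $ i))"
    using assms by (auto simp: scalar_prod_def atLeast0LessThan norm_mult intro!: order_trans[OF norm_sum] sum_mono)
  then have "(cmod (v \<bullet>c w))\<^sup>2 \<le> (\<Sum>i<n. cmod (v $ i) * cmod (w $ i))\<^sup>2"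
    by (intro power_mono) auto
  also have "\<dots> \<le> sqn v * sqn w"
    using assms by (auto simp: sqn_def intro: Cauchy_Schwarz_ineq_sum)
  finally show ?thesis .
qed

lemma cscalar_prod_adjoint:
  fixes C :: "complex mat"
  assumes C: "C \<in> carrier_mat m n" and v: "v \<in> carrier_vec n" and w: "w \<in> carrier_vec m"
  shows "(C *\<^sub>v v) \<bullet>c w = v \<bullet>c (mat_adjoint C *\<^sub>v w)"
proof -
  have "(C *\<^sub>v v) \<bullet>c w = (\<Sum>i<m. \<Sum>j<n. C $$ (i, j) * v $ j * cnj (w $ i))"
    using assms by (auto simp: scalar_prod_def atLeast0LessThan sum_distrib_right intro!: sum.cong)
  also have "\<dots> = (\<Sum>j<n. \<Sum>i<m. C $$ (i, j) * v $ j * cnj (w $ i))"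
    by (rule sum.swap)
  also have "\<dots> = v \<bullet>c (mat_adjoint C *\<^sub>v w)"
    using assms by (auto simp: scalar_prod_def atLeast0LessThan sum_distrib_left mult_ac intro!: sum.cong)
  finally show ?thesis .
qed

text \<open>Spectral norm at most one, for rectangular matrices too. Squared lengths avoid both
  square roots and an operator norm.\<close>

definition contraction :: "complex mat \<Rightarrow> bool" where
  "contraction C \<longleftrightarrow> (\<forall>v \<in> carrier_vec (dim_col C). sqn (C *\<^sub>v v) \<le> sqn v)"

text \<open>For \<open>u = mat_adjoint C *\<^sub>v w\<close>, the squared length of \<open>u\<close>
  is the inner product of \<open>C *\<^sub>v u\<close> with \<open>w\<close>. Cauchy-Schwarz and the
  contractivity of \<open>C\<close> bound its square by \<open>sqn u * sqn w\<close>, and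
  \<open>sqn u\<close> cancels.\<close>

lemma contraction_adjoint:
  assumes "contraction C"
  shows "contraction (mat_adjoint C)"
  unfolding contraction_def
proof
  fix w :: "complex vec" assume w: "w \<in> carrier_vec (dim_col (mat_adjoint C))"
  define u where "u = mat_adjoint C *\<^sub>v w"
  have C: "C \<in> carrier_mat (dim_row C) (dim_col C)" by simp
  have u: "u \<in> carrier_vec (dim_col C)" by (simp add: u_def carrier_vecI)
  have w': "w \<in> carrier_vec (dim_row C)" using w by simp
  have "complex_of_real (sqn u) = (C *\<^sub>v u) \<bullet>c w"
    using cscalar_prod_adjoint[OF C u w'] by (simp add: of_real_sqn u_def)
  then have "(sqn u)\<^sup>2 = (cmod ((C *\<^sub>v u) \<bullet>c w))\<^sup>2"
    by (metis norm_of_real power2_abs)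
  also have "\<dots> \<le> sqn (C *\<^sub>v u) * sqn w"
    using w' by (intro cscalar_prod_cauchy_schwarz[where n="dim_row C"]) (auto intro: carrier_vecI)
  also have "\<dots> \<le> sqn u * sqn w"
    using assms u by (intro mult_right_mono sqn_nonneg) (auto simp: contraction_def)
  finally show "sqn u \<le> sqn w"
    using sqn_nonneg[of u] sqn_nonneg[of w] by (cases "sqn u = 0") (auto simp: power2_eq_square)
qed

lemma contraction_mult:
  assumes "C \<in> carrier_mat m n" "D \<in> carrier_mat n r" "contraction C" "contraction D"
  shows "contraction (C * D)"
  unfolding contraction_def
proof
  fix v :: "complex vec" assume "v \<in> carrier_vec (dim_col (C * D))"
  then have v: "v \<in> carrier_vec r" using assms by simp
  have Dv: "D *\<^sub>v v \<in> carrier_vec n" using assms v by simp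
  have "sqn ((C * D) *\<^sub>v v) = sqn (C *\<^sub>v (D *\<^sub>v v))" using assms v by (simp add: assoc_mult_mat_vec)
  also have "\<dots> \<le> sqn (D *\<^sub>v v)" using assms Dv by (auto simp: contraction_def)
  also have "\<dots> \<le> sqn v" using assms v by (auto simp: contraction_def)
  finally show "sqn ((C * D) *\<^sub>v v) \<le> sqn v" .
qed

text \<open>The squared length of \<open>C *\<^sub>v v\<close> is the quadratic form of the Gram
  matrix, a weighted sum of the squared moduli of the entries of \<open>v\<close>. This one
  criterion serves isometries, diagonal matrices and partial isometries whose Gram matrix is a
  coordinate projection.\<close>

lemma contraction_if_gram_diagonal:
  assumes C: "C \<in> carrier_mat m n" and gram: "mat_adjoint C * C = dmat n (\<lambda>i. complex_of_real (d i))"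
    and d: "\<And>i. i < n \<Longrightarrow> d i \<le> 1"
  shows "contraction C"
  unfolding contraction_def
proof
  fix v :: "complex vec" assume "v \<in> carrier_vec (dim_col C)"
  then have v: "v \<in> carrier_vec n" using C by simp
  have "complex_of_real (sqn (C *\<^sub>v v)) = v \<bullet>c (mat_adjoint C *\<^sub>v (C *\<^sub>v v))"
    unfolding of_real_sqn by (rule cscalar_prod_adjoint[OF C v]) (use C v in auto)
  also have "mat_adjoint C *\<^sub>v (C *\<^sub>v v) = dmat n (\<lambda>i. complex_of_real (d i)) *\<^sub>v v"
    using C v by (subst gram[symmetric]) (auto simp: assoc_mult_mat_vec[of _ n m _ n])
  also have "v \<bullet>c (dmat n (\<lambda>i. complex_of_real (d i)) *\<^sub>v v) = (\<Sum>i<n. v $ i * cnj (complex_of_real (d i) * v $ i))"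
    using v by (auto simp: scalar_prod_def atLeast0LessThan if_distrib[of "\<lambda>x. x * _"] cong: if_cong intro!: sum.cong)
  also have "\<dots> = complex_of_real (\<Sum>i<n. d i * (cmod (v $ i))\<^sup>2)"
    by (auto simp: complex_norm_square mult_ac simp del: of_real_power intro!: sum.cong)
  finally have "sqn (C *\<^sub>v v) = (\<Sum>i<n. d i * (cmod (v $ i))\<^sup>2)"
    using of_real_eq_iff by blast
  also have "\<dots> \<le> (\<Sum>i<n. 1 * (cmod (v $ i))\<^sup>2)"
    by (intro sum_mono mult_right_mono d) auto
  also have "\<dots> = sqn v" using v by (simp add: sqn_def)
  finally show "sqn (C *\<^sub>v v) \<le> sqn v" .
qed

lemma contraction_isometry:
  assumes "C \<in> carrier_mat m n" "mat_adjoint C * C = 1\<^sub>m n"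
  shows "contraction C"
  using assms by (intro contraction_if_gram_diagonal[where d="\<lambda>_. 1"]) (auto simp: dmat_one)

lemma contraction_dmat:
  assumes "\<And>i. i < n \<Longrightarrow> cmod (d i) \<le> 1"
  shows "contraction (dmat n d)"
proof (rule contraction_if_gram_diagonal[where d="\<lambda>i. (cmod (d i))\<^sup>2"])
  show "mat_adjoint (dmat n d) * dmat n d = dmat n (\<lambda>i. complex_of_real ((cmod (d i))\<^sup>2))"
    by (auto simp: adjoint_dmat dmat_mult_dmat complex_norm_square mult_ac simp del: of_real_power intro: dmat_cong)
qed (use assms in \<open>auto simp: power_le_one\<close>)

text \<open>A column is the image of a unit vector.\<close>

lemma contraction_column:
  assumes C: "C \<in> carrier_mat m n" and "contraction C" and j: "j < n"
  shows "(\<Sum>i<m. (cmod (C $$ (i, j)))\<^sup>2) \<le> 1"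
proof -
  have "sqn (C *\<^sub>v unit_vec n j) \<le> sqn (unit_vec n j)"
    using assms by (auto simp: contraction_def)
  moreover have "sqn (C *\<^sub>v unit_vec n j) = (\<Sum>i<m. (cmod (C $$ (i, j)))\<^sup>2)"
    using C j by (auto simp: sqn_def intro!: sum.cong)
  moreover have "sqn (unit_vec n j) = (\<Sum>i<n. if i = j then 1 else 0)"
    using j unfolding sqn_def by (intro sum.cong) (auto simp: unit_vec_def)
  ultimately show ?thesis using j by simp
qed

lemma contraction_row:
  assumes C: "C \<in> carrier_mat m n" and "contraction C" and i: "i < m"
  shows "(\<Sum>j<n. (cmod (C $$ (i, j)))\<^sup>2) \<le> 1"
  using contraction_column[OF adjoint_carrier[OF C] contraction_adjoint i] assms by simp

lemma sum_mult_le_one: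
  fixes a b :: "nat \<Rightarrow> real"
  assumes "(\<Sum>i<n. (a i)\<^sup>2) \<le> 1" and "(\<Sum>i<n. (b i)\<^sup>2) \<le> 1"
  shows "(\<Sum>i<n. a i * b i) \<le> 1"
proof -
  have "(\<Sum>i<n. a i * b i)\<^sup>2 \<le> (\<Sum>i<n. (a i)\<^sup>2) * (\<Sum>i<n. (b i)\<^sup>2)"
    by (rule Cauchy_Schwarz_ineq_sum)
  also have "\<dots> \<le> 1" using assms by (intro mult_le_one sum_nonneg) auto
  finally show ?thesis using power2_le_imp_le[of _ 1] by simp
qed

text \<open>The diagonal entry at \<open>i\<close> is a combination of the \<open>s j\<close> with
  weights of modulus \<open>?w i j\<close>. By Cauchy-Schwarz on rows and columns of the
  contractions \<open>X\<close> and \<open>Y\<close>, these moduli form a doubly substochastic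
  matrix.\<close>

lemma lp_norm_diagonal_le:
  assumes p: "1 \<le> p" and X: "X \<in> carrier_mat r n" "contraction X" and Y: "Y \<in> carrier_mat n r" "contraction Y"
    and s: "\<And>j. j < n \<Longrightarrow> 0 \<le> s j"
  shows "lp_norm p r (\<lambda>i. cmod ((X * dmat n (\<lambda>j. complex_of_real (s j)) * Y) $$ (i, i))) \<le> lp_norm p n s"
proof -
  let ?w = "\<lambda>i j. cmod (X $$ (i, j)) * cmod (Y $$ (j, i))"
  have "lp_norm p r (\<lambda>i. cmod ((X * dmat n (\<lambda>j. complex_of_real (s j)) * Y) $$ (i, i)))
      \<le> lp_norm p r (\<lambda>i. \<Sum>j<n. ?w i j * s j)"
  proof (rule lp_norm_mono[OF p])
    fix i assume i: "i < r"
    have "(X * dmat n (\<lambda>j. complex_of_real (s j)) * Y) $$ (i, i)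
        = (\<Sum>j<n. X $$ (i, j) * complex_of_real (s j) * Y $$ (j, i))"
      using X Y i by (subst mult_mat_index[of _ r n _ r]) (auto intro!: sum.cong)
    also have "cmod \<dots> \<le> (\<Sum>j<n. ?w i j * s j)"
      using s by (intro order_trans[OF norm_sum] sum_mono) (auto simp: norm_mult)
    finally show "cmod ((X * dmat n (\<lambda>j. complex_of_real (s j)) * Y) $$ (i, i)) \<le> (\<Sum>j<n. ?w i j * s j)" .
  qed auto
  also have "\<dots> \<le> lp_norm p n s"
    using X Y by (intro lp_norm_substochastic[OF p _ s] sum_mult_le_one contraction_row contraction_column) auto
  finally show ?thesis .
qed

section \<open>Singular value decomposition\<close>

lemma mult_mat_assoc_dim:
  "dim_col A = dim_row B \<Longrightarrow> dim_col B = dim_row C \<Longrightarrow> (A * B) * C = A * (B * (C :: 'a::semiring_0 mat))"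
  by (rule assoc_mult_mat[of _ "dim_row A" "dim_col A" _ "dim_col B" _ "dim_col C"]) auto

lemma adjoint_mult_dim:
  "dim_col A = dim_row B \<Longrightarrow> mat_adjoint (A * B) = mat_adjoint B * mat_adjoint (A :: complex mat)"
  by (rule adjoint_mult[of _ "dim_row A" "dim_col A" _ "dim_col B"]) auto

lemma gram_index:
  fixes A :: "complex mat"
  assumes "i < dim_col A"
  shows "(mat_adjoint A * A) $$ (i, i) = complex_of_real (\<Sum>k<dim_row A. (cmod (A $$ (k, i)))\<^sup>2)"
  using assms by (subst mult_mat_index[of _ "dim_col A" "dim_row A" _ "dim_col A"])
    (auto simp: complex_norm_square mult.commute simp del: of_real_power intro!: sum.cong)

text \<open>Extend \<open>v\<close> to a basis, orthogonalise by Gram-Schmidt, which keeps the first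
  vector, and normalise the columns. The scalar \<open>c\<close> is the normalising factor of the
  first column.\<close>

lemma unitary_completion:
  fixes v :: "complex vec"
  assumes v: "v \<in> carrier_vec n" "v \<noteq> 0\<^sub>v n"
  shows "\<exists>W c. W \<in> carrier_mat n n \<and> mat_adjoint W * W = 1\<^sub>m n \<and> (\<forall>i<n. W $$ (i, 0) = c * v $ i)"
proof -
  interpret cof_vec_space n "TYPE(complex)" .
  define ws where "ws = gram_schmidt n (basis_completion v)"
  define X where "X = mat_of_cols n ws"
  note bc = basis_completion[OF v]
  have n: "0 < n" using v by (cases n) auto
  from bc(6,7) n obtain vs where vs: "basis_completion v = v # vs"
    by (cases "basis_completion v") auto
  have ws: "set ws \<subseteq> carrier_vec n" "corthogonal ws" "length ws = n"
    using gram_schmidt_result[OF bc(2,4,5) refl, folded ws_def] bc(6) by auto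
  have hdws: "hd ws = v" unfolding ws_def vs by (rule gram_schmidt_hd[OF v(1)])
  have X: "X \<in> carrier_mat n n" using ws(3) by (auto simp: X_def)
  have X0: "X $$ (i, 0) = v $ i" if "i < n" for i
    using that hdws ws(3) n by (cases ws) (auto simp: X_def mat_of_cols_def)
  \<comment> \<open>The squared lengths of the columns of \<open>X\<close>. They are the diagonal of
    its Gram matrix and are positive, so that scaling by their inverse square roots makes the
    columns orthonormal.\<close>
  define q where "q i = (\<Sum>k<n. (cmod (X $$ (k, i)))\<^sup>2)" for i
  have orth: "corthogonal_mat X" unfolding X_def by (rule orthogonal_mat_of_cols[OF ws])
  have gram: "mat_adjoint X * X = dmat n (\<lambda>i. complex_of_real (q i))"
    using orth X gram_index[of _ X] by (intro eq_matI) (auto simp: corthogonal_mat_def Let_def diagonal_mat_def q_def)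
  have "q i \<noteq> 0" if "i < n" for i
  proof
    assume "q i = 0"
    then have "(mat_adjoint X * X) $$ (i, i) = 0" using that gram by simp
    then show False using orth that X by (auto simp: corthogonal_mat_def Let_def)
  qed
  moreover have "0 \<le> q i" for i by (auto simp: q_def intro: sum_nonneg)
  ultimately have q: "0 < q i" if "i < n" for i using that by (simp add: order_less_le)
  define D where "D = dmat n (\<lambda>i. complex_of_real (1 / sqrt (q i)))"
  have "mat_adjoint (X * D) * (X * D) = mat_adjoint D * (mat_adjoint X * X) * D"
    using X by (simp add: adjoint_mult_dim mult_mat_assoc_dim D_def)
  also have "\<dots> = dmat n (\<lambda>i. complex_of_real (1 / sqrt (q i) * q i * (1 / sqrt (q i))))"
    unfolding gram D_def adjoint_dmat dmat_mult_dmat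
    by (rule dmat_cong) (simp only: complex_cnj_complex_of_real of_real_mult)
  also have "\<dots> = dmat n (\<lambda>_. 1)"
  proof (rule dmat_cong)
    fix i assume "i < n"
    then have "1 / sqrt (q i) * q i * (1 / sqrt (q i)) = 1"
      using q[of i] by (simp add: divide_simps)
    then show "complex_of_real (1 / sqrt (q i) * q i * (1 / sqrt (q i))) = 1" by (simp only: of_real_1)
  qed
  finally have "mat_adjoint (X * D) * (X * D) = 1\<^sub>m n" by (simp add: dmat_one)
  moreover have "(X * D) $$ (i, 0) = complex_of_real (1 / sqrt (q 0)) * v $ i" if "i < n" for i
    using that n X X0 by (simp add: D_def)
  moreover have "X * D \<in> carrier_mat n n" using X by (auto simp: D_def)
  ultimately show ?thesis by blast
qed

text \<open>The block diagonal matrix with the 1 by 1 block \<open>c\<close> followed by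
  \<open>M\<close>; it carries the deflation step of the spectral theorem.\<close>

definition bordered :: "'a::zero \<Rightarrow> 'a mat \<Rightarrow> 'a mat" where
  "bordered c M = mat (Suc (dim_row M)) (Suc (dim_col M))
     (\<lambda>(i, j). case i of 0 \<Rightarrow> (case j of 0 \<Rightarrow> c | Suc _ \<Rightarrow> 0)
                      | Suc i' \<Rightarrow> (case j of 0 \<Rightarrow> 0 | Suc j' \<Rightarrow> M $$ (i', j')))"

lemma bordered_dim [simp]:
  "dim_row (bordered c M) = Suc (dim_row M)" "dim_col (bordered c M) = Suc (dim_col M)"
  by (auto simp: bordered_def)

lemma bordered_index [simp]:
  "i < dim_row M \<Longrightarrow> j < dim_col M \<Longrightarrow> bordered c M $$ (Suc i, Suc j) = M $$ (i, j)"
  "i < dim_row M \<Longrightarrow> bordered c M $$ (Suc i, 0) = 0"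
  "j < dim_col M \<Longrightarrow> bordered c M $$ (0, Suc j) = 0"
  "bordered c M $$ (0, 0) = c"
  by (auto simp: bordered_def)

lemma bordered_mult:
  fixes M N :: "'a::semiring_1 mat"
  assumes "dim_col M = dim_row N"
  shows "bordered c M * bordered d N = bordered (c * d) (M * N)"
proof (rule eq_matI)
  fix i j assume "i < dim_row (bordered (c * d) (M * N))" "j < dim_col (bordered (c * d) (M * N))"
  then have ij: "i < Suc (dim_row M)" "j < Suc (dim_col N)" by auto
  have MN: "(M * N) $$ (a, b) = (\<Sum>k<dim_row N. M $$ (a, k) * N $$ (k, b))"
    if "a < dim_row M" "b < dim_col N" for a b
    using that assms by (intro mult_mat_index) auto
  have "(bordered c M * bordered d N) $$ (i, j)
      = (\<Sum>k<Suc (dim_col M). bordered c M $$ (i, k) * bordered d N $$ (k, j))"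
    using ij assms by (intro mult_mat_index[of _ "Suc (dim_row M)" _ _ "Suc (dim_col N)"]) (auto intro: carrier_matI)
  also have "\<dots> = bordered (c * d) (M * N) $$ (i, j)"
    using ij assms unfolding sum.lessThan_Suc_shift
    by (cases i; cases j) (auto simp: MN)
  finally show "(bordered c M * bordered d N) $$ (i, j) = bordered (c * d) (M * N) $$ (i, j)" .
qed (use assms in auto)

lemma adjoint_bordered: "mat_adjoint (bordered c M) = bordered (cnj c) (mat_adjoint M)"
proof (rule eq_matI)
  fix i j assume "i < dim_row (bordered (cnj c) (mat_adjoint M))" "j < dim_col (bordered (cnj c) (mat_adjoint M))"
  then show "mat_adjoint (bordered c M) $$ (i, j) = bordered (cnj c) (mat_adjoint M) $$ (i, j)"
    by (cases i; cases j) auto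
qed auto

lemma bordered_dmat: "bordered c (dmat n d) = dmat (Suc n) (case_nat c d)"
proof (rule eq_matI)
  fix i j assume "i < dim_row (dmat (Suc n) (case_nat c d))" "j < dim_col (dmat (Suc n) (case_nat c d))"
  then show "bordered c (dmat n d) $$ (i, j) = dmat (Suc n) (case_nat c d) $$ (i, j)"
    by (cases i; cases j) auto
qed auto

lemma bordered_one: "bordered 1 (1\<^sub>m n) = 1\<^sub>m (Suc n)"
  unfolding dmat_one[symmetric] bordered_dmat by (rule dmat_cong) (simp split: nat.split)

lemma complex_eigenvector_exists:
  fixes H :: "complex mat"
  assumes H: "H \<in> carrier_mat n n" and n: "0 < n"
  shows "\<exists>v e. v \<in> carrier_vec n \<and> v \<noteq> 0\<^sub>v n \<and> H *\<^sub>v v = e \<cdot>\<^sub>v v"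
proof -
  have "degree (char_poly H) \<noteq> 0" using degree_monic_char_poly[OF H] n by simp
  then obtain e where "poly (char_poly H) e = 0"
    using fundamental_theorem_of_algebra[of "char_poly H"] constant_degree[of "char_poly H"] by auto
  then have "eigenvalue H e" using eigenvalue_root_char_poly[OF H] by simp
  then show ?thesis using H unfolding eigenvalue_def eigenvector_def by auto
qed

text \<open>Deflation: in an orthonormal basis that starts with an eigenvector, the first column of
  \<open>H\<close> is the eigenvalue followed by zeros. Self-adjointness clears the first row as
  well, and induction applies to the remaining self-adjoint block.\<close>

lemma hermitian_diagonalization:
  fixes H :: "complex mat"
  assumes "H \<in> carrier_mat n n" and "mat_adjoint H = H"
  shows "\<exists>V d. V \<in> carrier_mat n n \<and> mat_adjoint V * V = 1\<^sub>m n \<and> mat_adjoint V * H * V = dmat n d"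
  using assms
proof (induction n arbitrary: H)
  case 0
  then show ?case by (intro exI[of _ "1\<^sub>m 0"] exI[of _ "\<lambda>_. 0"]) (auto intro: eq_matI)
next
  case (Suc n)
  note H = Suc.prems(1)
  obtain v e where v: "v \<in> carrier_vec (Suc n)" "v \<noteq> 0\<^sub>v (Suc n)" "H *\<^sub>v v = e \<cdot>\<^sub>v v"
    using complex_eigenvector_exists[OF H] by blast
  obtain W c where W: "W \<in> carrier_mat (Suc n) (Suc n)" "mat_adjoint W * W = 1\<^sub>m (Suc n)"
    and W0: "\<And>i. i < Suc n \<Longrightarrow> W $$ (i, 0) = c * v $ i"
    using unitary_completion[OF v(1,2)] by blast
  define K where "K = mat_adjoint W * H * W"
  have K: "K \<in> carrier_mat (Suc n) (Suc n)" using W H by (auto simp: K_def)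
  have KH: "mat_adjoint K = K"
    using W(1) H Suc.prems(2) by (simp add: K_def adjoint_mult_dim mult_mat_assoc_dim)
  have HW0: "(H * W) $$ (k, 0) = e * W $$ (k, 0)" if k: "k < Suc n" for k
  proof -
    have "(H * W) $$ (k, 0) = (\<Sum>j<Suc n. H $$ (k, j) * W $$ (j, 0))"
      using H W k by (intro mult_mat_index) auto
    also have "\<dots> = c * (\<Sum>j<Suc n. H $$ (k, j) * v $ j)"
      unfolding sum_distrib_left by (intro sum.cong) (auto simp: W0 mult_ac)
    also have "(\<Sum>j<Suc n. H $$ (k, j) * v $ j) = (H *\<^sub>v v) $ k"
      using H v(1) k by (auto simp: scalar_prod_def atLeast0LessThan simp del: sum.lessThan_Suc intro!: sum.cong)
    finally show ?thesis using v k by (simp add: W0)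
  qed
  have col0: "K $$ (i, 0) = (if i = 0 then e else 0)" if i: "i < Suc n" for i
  proof -
    have "K $$ (i, 0) = (mat_adjoint W * (H * W)) $$ (i, 0)"
      using W(1) H by (simp add: K_def mult_mat_assoc_dim)
    also have "\<dots> = (\<Sum>k<Suc n. mat_adjoint W $$ (i, k) * (H * W) $$ (k, 0))"
      using H W i by (intro mult_mat_index[of _ "Suc n" _ _ "Suc n"]) auto
    also have "\<dots> = e * (\<Sum>k<Suc n. mat_adjoint W $$ (i, k) * W $$ (k, 0))"
      unfolding sum_distrib_left by (intro sum.cong) (auto simp: HW0 mult_ac)
    also have "(\<Sum>k<Suc n. mat_adjoint W $$ (i, k) * W $$ (k, 0)) = (mat_adjoint W * W) $$ (i, 0)"
      using W(1) i by (intro mult_mat_index[symmetric]) auto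
    finally show ?thesis using i by (simp add: W(2))
  qed
  have row0: "K $$ (0, j) = (if j = 0 then cnj e else 0)" if j: "j < Suc n" for j
  proof -
    have "K $$ (0, j) = cnj (K $$ (j, 0))" using K j by (subst KH[symmetric]) simp
    then show ?thesis using col0[OF j] by simp
  qed
  define M where "M = mat n n (\<lambda>(i, j). K $$ (Suc i, Suc j))"
  have M: "M \<in> carrier_mat n n" by (simp add: M_def)
  have KM: "K = bordered e M"
  proof (rule eq_matI)
    fix i j assume "i < dim_row (bordered e M)" "j < dim_col (bordered e M)"
    then show "K $$ (i, j) = bordered e M $$ (i, j)"
      using row0 col0 by (cases i; cases j) (auto simp: M_def)
  qed (use K M in auto)
  have "mat_adjoint M = M"
  proof (rule eq_matI)
    fix i j assume "i < dim_row M" "j < dim_col M"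
    then have ij: "i < n" "j < n" using M by auto
    have "K $$ (Suc i, Suc j) = cnj (K $$ (Suc j, Suc i))" using K ij by (subst KH[symmetric]) simp
    then show "mat_adjoint M $$ (i, j) = M $$ (i, j)" using ij by (simp add: M_def)
  qed (use M in auto)
  from Suc.IH[OF M this] obtain V d where V: "V \<in> carrier_mat n n" "mat_adjoint V * V = 1\<^sub>m n"
    and D: "mat_adjoint V * M * V = dmat n d" by blast
  let ?B = "bordered 1 V"
  have Badj: "mat_adjoint ?B \<in> carrier_mat (Suc n) (Suc n)"
    using V(1) by (intro carrier_matI) auto
  have B: "mat_adjoint ?B * ?B = 1\<^sub>m (Suc n)"
    using V by (simp add: adjoint_bordered bordered_mult bordered_one)
  have "mat_adjoint (W * ?B) * (W * ?B) = mat_adjoint ?B * (mat_adjoint W * W) * ?B"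
    using W(1) V(1) by (simp add: adjoint_mult_dim mult_mat_assoc_dim)
  also have "\<dots> = 1\<^sub>m (Suc n)"
    unfolding W(2) by (subst right_mult_one_mat[OF Badj]) (rule B)
  finally have 1: "mat_adjoint (W * ?B) * (W * ?B) = 1\<^sub>m (Suc n)" .
  have "mat_adjoint (W * ?B) * H * (W * ?B) = mat_adjoint ?B * K * ?B"
    using W(1) V(1) H by (simp add: adjoint_mult_dim mult_mat_assoc_dim K_def)
  also have "\<dots> = bordered e (mat_adjoint V * M * V)"
    using V(1) M by (simp add: KM adjoint_bordered bordered_mult)
  also have "\<dots> = dmat (Suc n) (case_nat e d)" by (simp add: D bordered_dmat)
  finally have "mat_adjoint (W * ?B) * H * (W * ?B) = dmat (Suc n) (case_nat e d)" .
  moreover have "W * ?B \<in> carrier_mat (Suc n) (Suc n)" using W(1) V(1) by (auto intro: carrier_matI)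
  ultimately show ?case using 1 by blast
qed

text \<open>A unitary similarity keeps the characteristic polynomial, and the roots for a diagonal
  matrix are its diagonal entries, with multiplicity.\<close>

lemma sing_vals_eq:
  assumes A: "A \<in> carrier_mat m n" and V: "V \<in> carrier_mat n n" "mat_adjoint V * V = 1\<^sub>m n"
    and D: "mat_adjoint V * (mat_adjoint A * A) * V = dmat n d"
  shows "sing_vals A = mset (map (\<lambda>i. sqrt (Re (d i))) [0..<n])"
proof -
  let ?H = "mat_adjoint A * A"
  have VV: "V * mat_adjoint V = 1\<^sub>m n"
    using mat_mult_left_right_inverse[of "mat_adjoint V" n V] V by auto
  have "V * dmat n d * mat_adjoint V = (V * mat_adjoint V) * ?H * (V * mat_adjoint V)"
    using A V(1) by (simp add: D[symmetric] mult_mat_assoc_dim)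
  then have "?H = V * dmat n d * mat_adjoint V" using A by (simp add: VV)
  then have "similar_mat_wit ?H (dmat n d) V (mat_adjoint V)"
    using A V VV by (auto simp: similar_mat_wit_def Let_def)
  then have "char_poly ?H = char_poly (dmat n d)"
    by (intro char_poly_similar) (auto simp: similar_mat_def)
  also have "\<dots> = (\<Prod>a\<leftarrow>diag_mat (dmat n d). [:- a, 1:])"
    by (rule char_poly_upper_triangular[of _ n]) auto
  also have "diag_mat (dmat n d) = map d [0..<n]" by (auto simp: diag_mat_def)
  finally have cp: "char_poly ?H = (\<Prod>q\<leftarrow>map (\<lambda>i. [:- d i, 1:]) [0..<n]. q)" by (simp add: o_def)
  have "proots (char_poly ?H) = (\<Sum>q\<leftarrow>map (\<lambda>i. [:- d i, 1:]) [0..<n]. proots q)"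
    unfolding cp by (rule proots_prod_list) auto
  also have "\<dots> = (\<Sum>i\<leftarrow>[0..<n]. {#d i#})" by (simp add: o_def)
  also have "\<dots> = mset (map d [0..<n])" by (induction n) auto
  finally show ?thesis unfolding sing_vals_def by (simp add: multiset.map_comp o_def)
qed

lemma schatten_eq_lp_norm:
  assumes "sing_vals A = mset (map s [0..<n])"
  shows "schatten p A = lp_norm p n s"
proof -
  have "(\<Sum>x\<in>#sing_vals A. x powr r) = (\<Sum>i<n. s i powr r)" for r
    unfolding assms by (simp add: sum_mset_sum_list o_def interv_sum_list_conv_sum_set_nat atLeast0LessThan flip: mset_map)
  moreover have "set_mset (sing_vals A) = s ` {..<n}"
    unfolding assms by (auto simp: atLeast0LessThan)
  ultimately show ?thesis by (simp add: schatten_def lp_norm_def)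
qed

text \<open>Diagonalise the Gram matrix of \<open>A\<close> by a unitary \<open>V\<close>. The
  columns of \<open>Y = A * V\<close> are then orthogonal with the singular values as lengths, and
  dividing by these lengths gives \<open>U\<close>. Asking only that \<open>U\<close> be a
  contraction keeps the format \<open>m\<close> by \<open>n\<close> possible even if
  \<open>m < n\<close>.\<close>

lemma singular_value_decomposition:
  assumes A: "A \<in> carrier_mat m n"
  obtains U V s where "U \<in> carrier_mat m n" "contraction U" "V \<in> carrier_mat n n" "contraction V"
    "\<And>i. 0 \<le> s i" "\<And>p. schatten p A = lp_norm p n s"
    "A = U * dmat n (\<lambda>i. complex_of_real (s i)) * mat_adjoint V"
    "mat_adjoint U * A * V = dmat n (\<lambda>i. complex_of_real (s i))"
proof -
  have "mat_adjoint (mat_adjoint A * A) = mat_adjoint A * A" by (simp add: adjoint_mult_dim)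
  then obtain V d where V: "V \<in> carrier_mat n n" "mat_adjoint V * V = 1\<^sub>m n"
    and D: "mat_adjoint V * (mat_adjoint A * A) * V = dmat n d"
    using hermitian_diagonalization[OF mult_carrier_mat[OF adjoint_carrier[OF A] A]] by blast
  have VV: "V * mat_adjoint V = 1\<^sub>m n"
    using mat_mult_left_right_inverse[of "mat_adjoint V" n V] V by auto
  define Y where "Y = A * V"
  have Y: "Y \<in> carrier_mat m n" using A V by (auto simp: Y_def)
  have YD: "mat_adjoint Y * Y = dmat n d"
    using A V(1) by (simp add: Y_def D[symmetric] adjoint_mult_dim mult_mat_assoc_dim)
  define s where "s i = sqrt (\<Sum>k<m. (cmod (Y $$ (k, i)))\<^sup>2)" for i
  have s: "0 \<le> s i" for i by (auto simp: s_def intro: sum_nonneg)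
  have d: "d i = complex_of_real ((s i)\<^sup>2)" if "i < n" for i
  proof -
    have "d i = (mat_adjoint Y * Y) $$ (i, i)" using that by (simp add: YD)
    also have "\<dots> = complex_of_real ((s i)\<^sup>2)" using that Y
      by (subst gram_index) (auto simp: s_def sum_nonneg)
    finally show ?thesis .
  qed
  have Y0: "Y $$ (k, i) = 0" if "k < m" "s i = 0" for k i
    using that by (auto simp: s_def sum_nonneg_eq_0_iff)
  let ?S = "dmat n (\<lambda>i. complex_of_real (s i))"
  \<comment> \<open>Division by zero yields zero, so the columns of \<open>U\<close> belonging to zero singular values vanish.\<close>
  let ?T = "dmat n (\<lambda>i. complex_of_real (1 / s i))"
  define U where "U = Y * ?T"
  have U: "U \<in> carrier_mat m n" using Y by (auto simp: U_def)
  have "mat_adjoint U * U = ?T * dmat n d * ?T"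
    using Y by (simp add: U_def adjoint_mult_dim mult_mat_assoc_dim YD[symmetric] adjoint_dmat)
  also have "\<dots> = dmat n (\<lambda>i. complex_of_real (if s i = 0 then 0 else 1))"
    unfolding dmat_mult_dmat by (rule dmat_cong) (auto simp: d power2_eq_square)
  finally have "contraction U"
    by (rule contraction_if_gram_diagonal[OF U]) auto
  moreover have "contraction V" using V by (rule contraction_isometry)
  \<comment> \<open>Where a singular value is zero, the column of \<open>Y\<close> vanishes by
    \<open>Y0\<close>, so the zero column of \<open>U\<close> reproduces it.\<close>
  moreover have "U * ?S = Y" unfolding U_def using Y Y0
    by (intro eq_matI) (auto simp: mult_mat_assoc_dim dmat_mult_dmat)
  then have "U * ?S * mat_adjoint V = A * (V * mat_adjoint V)"
    using A V(1) by (simp add: Y_def mult_mat_assoc_dim)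
  then have "A = U * ?S * mat_adjoint V" using A by (simp add: VV)
  moreover have "mat_adjoint U * A * V = ?T * dmat n d"
    using A V(1) Y by (simp add: U_def adjoint_mult_dim mult_mat_assoc_dim YD[symmetric] adjoint_dmat Y_def)
  then have "mat_adjoint U * A * V = ?S"
    unfolding dmat_mult_dmat by (auto simp: d power2_eq_square intro: dmat_cong)
  moreover have "map (\<lambda>i. sqrt (Re (d i))) [0..<n] = map s [0..<n]"
    using s by (simp add: d)
  then have "sing_vals A = mset (map s [0..<n])"
    by (simp only: sing_vals_eq[OF A V D])
  ultimately show ?thesis
    by (intro that[OF U _ V(1) _ s schatten_eq_lp_norm])
qed

section \<open>Schatten norms\<close>

text \<open>Upper half of the variational formula: the outer factors of the singular value
  decomposition are absorbed into \<open>P\<close> and \<open>Q\<close>, which stay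
  contractions.\<close>

lemma lp_norm_diagonal_le_schatten:
  assumes p: "1 \<le> p" and A: "A \<in> carrier_mat m n"
    and P: "P \<in> carrier_mat r m" "contraction P" and Q: "Q \<in> carrier_mat n r" "contraction Q"
  shows "lp_norm p r (\<lambda>i. cmod ((P * A * Q) $$ (i, i))) \<le> schatten p A"
proof -
  obtain U V s where U: "U \<in> carrier_mat m n" "contraction U" and V: "V \<in> carrier_mat n n" "contraction V"
    and s: "\<And>i. 0 \<le> s i" "\<And>p. schatten p A = lp_norm p n s"
    and AUV: "A = U * dmat n (\<lambda>i. complex_of_real (s i)) * mat_adjoint V"
    by (rule singular_value_decomposition[OF A]) blast
  have "P * A * Q = (P * U) * dmat n (\<lambda>i. complex_of_real (s i)) * (mat_adjoint V * Q)"
    using P(1) Q(1) U(1) V(1) by (simp add: AUV mult_mat_assoc_dim)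
  moreover have "P * U \<in> carrier_mat r n" "mat_adjoint V * Q \<in> carrier_mat n r"
    using P Q U V by auto
  moreover have "contraction (P * U)" "contraction (mat_adjoint V * Q)"
    using contraction_mult[OF P(1) U(1)] contraction_mult[OF adjoint_carrier[OF V(1)] Q(1)]
      P Q U contraction_adjoint[OF V(2)] by auto
  ultimately show ?thesis
    unfolding s(2) using lp_norm_diagonal_le[OF p _ _ _ _ s(1)] by simp
qed

text \<open>Lower half of the variational formula: the adjoint of \<open>U\<close> and the matrix
  \<open>V\<close> of the decomposition put the singular values on the diagonal. The same pair works
  for all \<open>p\<close>.\<close>

lemma schatten_attained:
  assumes A: "A \<in> carrier_mat m n"
  obtains P Q where "P \<in> carrier_mat n m" "contraction P" "Q \<in> carrier_mat n n" "contraction Q"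
    "\<And>p. schatten p A = lp_norm p n (\<lambda>i. cmod ((P * A * Q) $$ (i, i)))"
proof -
  obtain U V s where U: "U \<in> carrier_mat m n" "contraction U" and V: "V \<in> carrier_mat n n" "contraction V"
    and s: "\<And>i. 0 \<le> s i" "\<And>p. schatten p A = lp_norm p n s"
    and S: "mat_adjoint U * A * V = dmat n (\<lambda>i. complex_of_real (s i))"
    by (rule singular_value_decomposition[OF A]) blast
  show ?thesis
  proof (rule that[OF adjoint_carrier[OF U(1)] contraction_adjoint[OF U(2)] V])
    show "schatten p A = lp_norm p n (\<lambda>i. cmod ((mat_adjoint U * A * V) $$ (i, i)))" for p
      unfolding s(2) S using s(1) by (intro lp_norm_cong) simp
  qed
qed

lemma schatten_nonneg: "0 \<le> schatten p A"
  by (rule schatten_attained[of A "dim_row A" "dim_col A"]) (auto simp: lp_norm_nonneg)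

text \<open>The pair of contractions that is optimal for \<open>A + B\<close> is admissible for
  \<open>A\<close> and for \<open>B\<close>, so Minkowski's inequality for the diagonals
  suffices.\<close>

lemma schatten_add:
  assumes p: "1 \<le> p" and A: "A \<in> carrier_mat m n" and B: "B \<in> carrier_mat m n"
  shows "schatten p (A + B) \<le> schatten p A + schatten p B"
proof -
  from A B have "A + B \<in> carrier_mat m n" by simp
  then obtain P Q where P: "P \<in> carrier_mat n m" "contraction P" and Q: "Q \<in> carrier_mat n n" "contraction Q"
    and eq: "\<And>p. schatten p (A + B) = lp_norm p n (\<lambda>i. cmod ((P * (A + B) * Q) $$ (i, i)))"
    by (rule schatten_attained) blast
  have dist: "P * (A + B) * Q = P * A * Q + P * B * Q"
    using A B P(1) Q(1) by (simp add: mult_add_distrib_mat[of P n m A n B] add_mult_distrib_mat[of _ n n _ Q n])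
  have "schatten p (A + B) \<le> lp_norm p n (\<lambda>i. cmod ((P * A * Q) $$ (i, i)) + cmod ((P * B * Q) $$ (i, i)))"
    unfolding eq dist using P(1) Q(1) by (intro lp_norm_mono[OF p]) (auto intro: norm_triangle_ineq)
  also have "\<dots> \<le> lp_norm p n (\<lambda>i. cmod ((P * A * Q) $$ (i, i))) + lp_norm p n (\<lambda>i. cmod ((P * B * Q) $$ (i, i)))"
    by (rule lp_norm_triangle[OF p]) auto
  also have "\<dots> \<le> schatten p A + schatten p B"
    by (rule add_mono[OF lp_norm_diagonal_le_schatten[OF p A P Q] lp_norm_diagonal_le_schatten[OF p B P Q]])
  finally show ?thesis .
qed

text \<open>\<open>C\<close> and \<open>D\<close> merge with the contractions over which the maximum
  is taken.\<close>

lemma schatten_contraction_mult: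
  assumes p: "1 \<le> p" and A: "A \<in> carrier_mat m n" and C: "C \<in> carrier_mat k m" "contraction C"
    and D: "D \<in> carrier_mat n l" "contraction D"
  shows "schatten p (C * A * D) \<le> schatten p A"
proof -
  from A C D have "C * A * D \<in> carrier_mat k l" by auto
  then obtain P Q where P: "P \<in> carrier_mat l k" "contraction P" and Q: "Q \<in> carrier_mat l l" "contraction Q"
    and eq: "\<And>p. schatten p (C * A * D) = lp_norm p l (\<lambda>i. cmod ((P * (C * A * D) * Q) $$ (i, i)))"
    by (rule schatten_attained) blast
  have "P * (C * A * D) * Q = (P * C) * A * (D * Q)"
    using A C(1) D(1) P(1) Q(1) by (simp add: mult_mat_assoc_dim)
  moreover have "P * C \<in> carrier_mat l m" "D * Q \<in> carrier_mat n l" using C D P Q by auto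
  moreover have "contraction (P * C)" "contraction (D * Q)"
    using contraction_mult[OF P(1) C(1)] contraction_mult[OF D(1) Q(1)] C D P Q by auto
  ultimately show ?thesis
    unfolding eq using lp_norm_diagonal_le_schatten[OF p A] by simp
qed

text \<open>Taking the adjoint of \<open>P * mat_adjoint A * Q\<close> conjugates the diagonal and
  gives a product of the same shape around \<open>A\<close>.\<close>

lemma schatten_adjoint_le:
  assumes p: "1 \<le> p"
  shows "schatten p (mat_adjoint A) \<le> schatten p A"
proof -
  define m n where "m = dim_row A" and "n = dim_col A"
  have A: "A \<in> carrier_mat m n" by (simp add: m_def n_def)
  obtain P Q where P: "P \<in> carrier_mat m n" "contraction P" and Q: "Q \<in> carrier_mat m m" "contraction Q"
    and eq: "\<And>p. schatten p (mat_adjoint A) = lp_norm p m (\<lambda>i. cmod ((P * mat_adjoint A * Q) $$ (i, i)))"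
    by (rule schatten_attained[OF adjoint_carrier[OF A]]) blast
  have "P * mat_adjoint A * Q = mat_adjoint (mat_adjoint Q * A * mat_adjoint P)"
    using A P(1) Q(1) by (simp add: adjoint_mult_dim mult_mat_assoc_dim)
  then have "schatten p (mat_adjoint A) = lp_norm p m (\<lambda>i. cmod ((mat_adjoint Q * A * mat_adjoint P) $$ (i, i)))"
    unfolding eq using P(1) Q(1) by (intro lp_norm_cong) simp
  also have "\<dots> \<le> schatten p A"
    using P Q by (intro lp_norm_diagonal_le_schatten[OF p A]) (auto intro: contraction_adjoint)
  finally show ?thesis .
qed

lemma schatten_adjoint: "1 \<le> p \<Longrightarrow> schatten p (mat_adjoint A) = schatten p A"
  using schatten_adjoint_le[of p A] schatten_adjoint_le[of p "mat_adjoint A"] by simp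

lemma schatten_dmat_le:
  assumes p: "1 \<le> p" and s: "\<And>i. i < n \<Longrightarrow> 0 \<le> s i"
  shows "schatten p (dmat n (\<lambda>i. complex_of_real (s i))) \<le> lp_norm p n s"
  by (rule schatten_attained[OF dmat_carrier[of n "\<lambda>i. complex_of_real (s i)"]])
    (auto intro: lp_norm_diagonal_le p s)

lemma schatten_zero:
  assumes p: "1 \<le> p"
  shows "schatten p (0\<^sub>m n n) = 0"
proof -
  have "0\<^sub>m n n = dmat n (\<lambda>i. complex_of_real ((\<lambda>_. 0) i))" by (rule eq_matI) auto
  then have "schatten p (0\<^sub>m n n) \<le> lp_norm p n (\<lambda>_. 0)"
    using schatten_dmat_le[OF p, of n "\<lambda>_. 0"] by simp
  also have "\<dots> \<le> 0" using lp_norm_scale[OF p, of 0 n "\<lambda>_. 0"] by simp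
  finally show ?thesis using schatten_nonneg[of p "0\<^sub>m n n"] by simp
qed

lemma schatten_uminus:
  assumes p: "1 \<le> p"
  shows "schatten p (- A) \<le> schatten p A"
proof -
  define m n where "m = dim_row A" and "n = dim_col A"
  have A: "A \<in> carrier_mat m n" by (simp add: m_def n_def)
  have "- A = dmat m (\<lambda>_. -1) * A * 1\<^sub>m n" using A by (intro eq_matI) auto
  also have "schatten p \<dots> \<le> schatten p A"
    unfolding dmat_one[symmetric] by (intro schatten_contraction_mult[OF p A] contraction_dmat) auto
  finally show ?thesis .
qed

text \<open>Each singular value of \<open>B\<close> is at most \<open>c\<close>, the Schatten norm
  of \<open>B\<close>, so \<open>B\<close> is \<open>c\<close> times a contraction \<open>K\<close>.
  In the variational formula for \<open>A * B\<close>, the matrix \<open>K\<close> merges with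
  \<open>Q\<close> and \<open>c\<close> comes out as a factor.\<close>

lemma schatten_mult:
  assumes p: "1 \<le> p" and A: "A \<in> carrier_mat m n" and B: "B \<in> carrier_mat n l"
  shows "schatten p (A * B) \<le> schatten p A * schatten p B"
proof -
  obtain U V s where U: "U \<in> carrier_mat n l" "contraction U" and V: "V \<in> carrier_mat l l" "contraction V"
    and s: "\<And>i. 0 \<le> s i" "\<And>p. schatten p B = lp_norm p l s"
    and BUV: "B = U * dmat l (\<lambda>i. complex_of_real (s i)) * mat_adjoint V"
    by (rule singular_value_decomposition[OF B]) blast
  define c where "c = schatten p B"
  have c: "0 \<le> c" by (simp add: c_def schatten_nonneg)
  have le: "s i \<le> c" if "i < l" for i
    using lp_norm_component[OF p that] s by (simp add: c_def)
  \<comment> \<open>If \<open>c = 0\<close>, all \<open>s i\<close> vanish too, and since division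
    by zero yields zero, \<open>s i = c * (s i / c)\<close> still holds.\<close>
  let ?S = "dmat l (\<lambda>i. complex_of_real (s i / c))"
  define K where "K = U * ?S * mat_adjoint V"
  have K: "K \<in> carrier_mat n l" using U V by (auto simp: K_def)
  have "contraction ?S"
  proof (rule contraction_dmat)
    fix i assume "i < l"
    then have "s i / c \<le> 1" using le[of i] c s(1)[of i] by (cases "c = 0") auto
    then show "cmod (complex_of_real (s i / c)) \<le> 1" unfolding norm_of_real using s(1)[of i] c by simp
  qed
  then have Kc: "contraction K" unfolding K_def
    using U V by (intro contraction_mult[of _ n l _ l] contraction_adjoint) auto
  have "dmat l (\<lambda>i. complex_of_real (s i)) = complex_of_real c \<cdot>\<^sub>m ?S"
  proof (rule eq_matI)
    fix i j assume "i < dim_row (complex_of_real c \<cdot>\<^sub>m ?S)" "j < dim_col (complex_of_real c \<cdot>\<^sub>m ?S)"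
    then show "dmat l (\<lambda>i. complex_of_real (s i)) $$ (i, j) = (complex_of_real c \<cdot>\<^sub>m ?S) $$ (i, j)"
      using le[of i] s(1)[of i] by (cases "c = 0") auto
  qed auto
  then have BK: "B = complex_of_real c \<cdot>\<^sub>m K"
    unfolding BUV K_def using U(1) V(1)
    by (simp add: mult_smult_distrib[of _ n l _ l] mult_smult_assoc_mat[of _ n l _ l])
  from A B have "A * B \<in> carrier_mat m l" by simp
  then obtain P Q where P: "P \<in> carrier_mat l m" "contraction P" and Q: "Q \<in> carrier_mat l l" "contraction Q"
    and eq: "\<And>p. schatten p (A * B) = lp_norm p l (\<lambda>i. cmod ((P * (A * B) * Q) $$ (i, i)))"
    by (rule schatten_attained) blast
  have "P * (A * B) * Q = complex_of_real c \<cdot>\<^sub>m (P * (A * K) * Q)"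
    unfolding BK using A K P(1) Q(1)
    by (simp add: mult_smult_distrib[of A m n K l] mult_smult_distrib[of P l m _ l] mult_smult_assoc_mat[of _ l l _ l])
  also have "P * (A * K) * Q = P * A * (K * Q)"
    using A K P(1) Q(1) by (simp add: mult_mat_assoc_dim)
  finally have "schatten p (A * B) = lp_norm p l (\<lambda>i. c * cmod ((P * A * (K * Q)) $$ (i, i)))"
    unfolding eq using P(1) Q(1) c by (intro lp_norm_cong) (simp add: norm_mult)
  also have "\<dots> \<le> c * lp_norm p l (\<lambda>i. cmod ((P * A * (K * Q)) $$ (i, i)))"
    by (rule lp_norm_scale[OF p c]) auto
  also have "\<dots> \<le> c * schatten p A"
    using contraction_mult[OF K Q(1) Kc Q(2)] K Q(1)
    by (intro mult_left_mono c lp_norm_diagonal_le_schatten[OF p A P]) auto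
  finally show ?thesis by (simp add: c_def mult.commute)
qed

text \<open>Selecting row \<open>i\<close> on the left and column \<open>j\<close> on the right are
  contractions, and they leave a 1 by 1 matrix with the nonzero entry. Positivity allows clearing
  the denominator in the growth factor.\<close>

lemma schatten_pos:
  assumes p: "1 \<le> p" and A: "A \<in> carrier_mat m n" and ij: "i < m" "j < n" and nz: "A $$ (i, j) \<noteq> 0"
  shows "0 < schatten p A"
proof -
  let ?P = "mat 1 m (\<lambda>(a, b). if b = i then 1 else 0) :: complex mat"
  let ?Q = "mat n 1 (\<lambda>(a, b). if a = j then 1 else 0) :: complex mat"
  have P: "contraction ?P"
  proof -
    have "mat_adjoint ?P * ?P = dmat m (\<lambda>a. complex_of_real (if a = i then 1 else 0))"
      by (rule eq_matI) (auto simp: mult_mat_index[of _ m 1 _ m])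
    then show ?thesis by (rule contraction_if_gram_diagonal[rotated]) auto
  qed
  have Q: "contraction ?Q"
  proof (rule contraction_isometry)
    show "mat_adjoint ?Q * ?Q = 1\<^sub>m 1"
      using ij by (intro eq_matI) (auto simp: mult_mat_index[of _ 1 n _ 1] if_distrib cong: if_cong)
  qed auto
  have PA: "(?P * A) $$ (0, b) = A $$ (i, b)" if "b < n" for b
    using that A ij by (subst mult_mat_index[of _ 1 m _ n]) (auto simp: if_distrib[of "\<lambda>x. x * _"] cong: if_cong)
  have "(?P * A * ?Q) $$ (0, 0) = (\<Sum>b<n. (?P * A) $$ (0, b) * ?Q $$ (b, 0))"
    using A by (subst mult_mat_index[of _ 1 n _ 1]) auto
  also have "\<dots> = (\<Sum>b<n. if b = j then A $$ (i, j) else 0)"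
    by (intro sum.cong) (auto simp: PA[simplified])
  also have "\<dots> = A $$ (i, j)" using ij by simp
  finally have entry: "(?P * A * ?Q) $$ (0, 0) = A $$ (i, j)" .
  have "0 < cmod (A $$ (i, j))" using nz by simp
  also have "\<dots> = lp_norm p 1 (\<lambda>i. cmod ((?P * A * ?Q) $$ (i, i)))"
    by (subst lp_norm_one[OF p]) (simp_all only: entry norm_ge_zero)
  also have "\<dots> \<le> schatten p A"
    by (rule lp_norm_diagonal_le_schatten[OF p A _ P _ Q]) auto
  finally show ?thesis .
qed

section \<open>Block triangular factors with unitary diagonal blocks\<close>

text \<open>Coordinate projections replace the passage to blocks: all matrices keep the format
  \<open>n\<close> by \<open>n\<close>, with zeros outside the block in question.\<close>

definition tail_proj :: "nat \<Rightarrow> nat \<Rightarrow> complex mat" where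
  "tail_proj n a = dmat n (\<lambda>i. if a \<le> i then 1 else 0)"

definition block_proj :: "nat \<Rightarrow> nat \<Rightarrow> nat \<Rightarrow> complex mat" where
  "block_proj n a b = dmat n (\<lambda>i. if a \<le> i \<and> i < b then 1 else 0)"

lemma tail_proj_carrier [simp, intro]: "tail_proj n a \<in> carrier_mat n n"
  by (simp add: tail_proj_def)

lemma block_proj_carrier [simp, intro]: "block_proj n a b \<in> carrier_mat n n"
  by (simp add: block_proj_def)

lemma proj_dim [simp]:
  "dim_row (tail_proj n a) = n" "dim_col (tail_proj n a) = n"
  "dim_row (block_proj n a b) = n" "dim_col (block_proj n a b) = n"
  by (simp_all add: tail_proj_def block_proj_def)

lemma adjoint_tail_proj: "mat_adjoint (tail_proj n a) = tail_proj n a"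
  by (auto simp: tail_proj_def adjoint_dmat intro: dmat_cong)

lemma contraction_block_proj: "contraction (block_proj n a b)"
  unfolding block_proj_def by (rule contraction_dmat) auto

lemma tail_proj_split: "a \<le> b \<Longrightarrow> tail_proj n a = block_proj n a b + tail_proj n b"
  by (rule eq_matI) (auto simp: tail_proj_def block_proj_def)

lemma tail_proj_zero: "tail_proj n 0 = 1\<^sub>m n"
  by (simp add: tail_proj_def dmat_one)

lemma tail_proj_end: "tail_proj n n = 0\<^sub>m n n"
  by (rule eq_matI) (auto simp: tail_proj_def)

lemma block_proj_idem: "block_proj n a b * block_proj n a b = block_proj n a b"
  by (auto simp: block_proj_def dmat_mult_dmat intro: dmat_cong)

lemma tail_mult_block_proj: "tail_proj n a * block_proj n a b = block_proj n a b"
  by (auto simp: tail_proj_def block_proj_def dmat_mult_dmat intro: dmat_cong)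

lemma dmat_mult_dmat_zero: "(\<And>i. d i * e i = (0 :: 'a::semiring_1)) \<Longrightarrow> dmat n d * dmat n e = 0\<^sub>m n n"
  by (simp add: dmat_mult_dmat) (auto intro: eq_matI)

lemma block_mult_tail_proj: "b \<le> c \<Longrightarrow> block_proj n a b * tail_proj n c = 0\<^sub>m n n"
  unfolding tail_proj_def block_proj_def by (rule dmat_mult_dmat_zero) auto

lemma tail_mult_block_proj_zero: "b \<le> c \<Longrightarrow> tail_proj n c * block_proj n a b = 0\<^sub>m n n"
  unfolding tail_proj_def block_proj_def by (rule dmat_mult_dmat_zero) auto

section \<open>Norms of block projections and telescoping sums\<close>

lemma root_p_mono: "1 \<le> p \<Longrightarrow> 0 \<le> x \<Longrightarrow> x \<le> y \<Longrightarrow> root_p p x \<le> root_p p y"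
  by (erule one_le_ereal_cases) (auto simp: root_p_def intro!: powr_mono2)

text \<open>The singular values are \<open>b - a\<close> ones and zeros otherwise. This is the
  origin of the factor \<open>root_p p\<close> of the block size.\<close>

lemma schatten_block_proj:
  assumes p: "1 \<le> p" and "a < b" "b \<le> n"
  shows "schatten p (block_proj n a b) \<le> root_p p (real (b - a))"
proof -
  have "block_proj n a b = dmat n (\<lambda>i. complex_of_real (if a \<le> i \<and> i < b then 1 else 0))"
    unfolding block_proj_def by (rule dmat_cong) simp
  then have "schatten p (block_proj n a b) \<le> lp_norm p n (\<lambda>i. if a \<le> i \<and> i < b then 1 else 0)"
    by (simp only:) (rule schatten_dmat_le[OF p], simp)
  then show ?thesis using lp_norm_indicator[OF assms] by (rule order_trans)
qed

text \<open>\<open>F 0\<close> is the sum of the \<open>N\<close> differences \<open>E k\<close>, so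
  the triangle inequality applies, by induction downwards from \<open>F N = 0\<close>. This is the
  origin of the factor counting the blocks.\<close>

lemma schatten_telescope:
  assumes p: "1 \<le> p" and F: "\<And>k. F k \<in> carrier_mat n n" and E: "\<And>k. E k \<in> carrier_mat n n"
    and end0: "F N = 0\<^sub>m n n" and step: "\<And>k. k < N \<Longrightarrow> F k = E k + F (Suc k)"
    and bound: "\<And>k. k < N \<Longrightarrow> schatten p (E k) \<le> c"
  shows "schatten p (F 0) \<le> real N * c"
proof -
  have "schatten p (F k) \<le> real (N - k) * c" if "k \<le> N" for k
    using that
  proof (induction rule: inc_induct)
    case base
    then show ?case by (simp add: end0 schatten_zero[OF p])
  next
    case (step k)
    have "schatten p (F k) \<le> schatten p (E k) + schatten p (F (Suc k))"
      using assms(5)[of k] step.hyps by (simp add: schatten_add[OF p E F])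
    also have "\<dots> \<le> c + real (N - Suc k) * c"
      using bound[of k] step by (intro add_mono) auto
    also have "\<dots> = real (N - k) * c"
      using step.hyps by (simp add: of_nat_diff algebra_simps)
    finally show ?case .
  qed
  from this[of 0] show ?thesis by simp
qed

text \<open>The setting shared by both cases, instantiated once with the factors and the inverse of
  \<open>A\<close> and once with the adjoints in reversed roles. \<open>lower\<close> says that
  \<open>L\<close> maps the range of each tail projection into itself, which is block lower
  triangularity; \<open>gram\<close> says that each padded diagonal block is a partial
  isometry.\<close>

locale unitary_block_lu =
  fixes n N :: nat and c :: "nat \<Rightarrow> nat" and L R B :: "complex mat"
  assumes L: "L \<in> carrier_mat n n" and R: "R \<in> carrier_mat n n" and B: "B \<in> carrier_mat n n"
    and inv: "L * R * B = 1\<^sub>m n"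
    and c0: "c 0 = 0" and cN: "c N = n" and c_less: "\<And>k. k < N \<Longrightarrow> c k < c (Suc k)"
    and lower: "\<And>k. k \<le> N \<Longrightarrow> L * tail_proj n (c k) = tail_proj n (c k) * L * tail_proj n (c k)"
    and gram: "\<And>k. k < N \<Longrightarrow> mat_adjoint (block_proj n (c k) (c (Suc k)) * L * block_proj n (c k) (c (Suc k)))
        * (block_proj n (c k) (c (Suc k)) * L * block_proj n (c k) (c (Suc k))) = block_proj n (c k) (c (Suc k))"
begin

abbreviation "T k \<equiv> tail_proj n (c k)"
abbreviation "P k \<equiv> block_proj n (c k) (c (Suc k))"
definition "D k = P k * L * P k"

lemma dims [simp]:
  "dim_row L = n" "dim_col L = n" "dim_row R = n" "dim_col R = n" "dim_row B = n" "dim_col B = n"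
  using L R B by auto

lemma D_carrier [simp, intro]: "D k \<in> carrier_mat n n"
  unfolding D_def by (intro mult_carrier_mat[of _ n n] L block_proj_carrier)

lemmas closed = mult_carrier_mat[of _ n n _ n] L R B adjoint_carrier[of _ n n] tail_proj_carrier block_proj_carrier D_carrier

lemma D_dim [simp]: "dim_row (D k) = n" "dim_col (D k) = n"
  by (auto simp: D_def)

lemma c_mono: "i \<le> j \<Longrightarrow> j \<le> N \<Longrightarrow> c i \<le> c j"
proof (induction rule: dec_induct)
  case (step k)
  then show ?case using c_less[of k] by simp
qed simp

lemma D_gram: "k < N \<Longrightarrow> mat_adjoint (D k) * D k = P k"
  using gram by (simp add: D_def)

lemma contraction_D: "k < N \<Longrightarrow> contraction (D k)"
  by (rule contraction_if_gram_diagonal[where n=n and m=n and d="\<lambda>i. if c k \<le> i \<and> i < c (Suc k) then 1 else 0"])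
    (auto simp: D_gram block_proj_def intro: dmat_cong)

lemma T_split: "k < N \<Longrightarrow> T k = P k + T (Suc k)"
  using c_less[of k] by (intro tail_proj_split) simp

text \<open>By \<open>lower\<close> a factor \<open>T (Suc k)\<close> can be inserted to the left of
  \<open>L\<close>, where \<open>P k\<close> annihilates it.\<close>

lemma block_row_tail:
  assumes k: "k < N"
  shows "P k * L * T (Suc k) = 0\<^sub>m n n"
proof -
  have "P k * L * T (Suc k) = P k * (L * T (Suc k))" by (simp add: mult_mat_assoc_dim)
  also have "\<dots> = (P k * T (Suc k)) * L * T (Suc k)"
    using k by (subst lower) (auto simp: mult_mat_assoc_dim)
  finally show ?thesis
    using L by (simp add: block_mult_tail_proj left_mult_zero_mat[of _ n n])
qed

lemma block_row:
  assumes k: "k < N"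
  shows "P k * L * T k = D k"
proof -
  have "P k * L * T k = P k * L * P k + P k * L * T (Suc k)"
    unfolding T_split[OF k] using L by (intro mult_add_distrib_mat[of _ n n _ n]) auto
  then show ?thesis using D_carrier[of k] by (simp add: block_row_tail[OF k] D_def[symmetric])
qed

text \<open>By \<open>lower\<close> block column \<open>k\<close> lives on the rows from block
  \<open>k\<close> on; splitting \<open>T k\<close> separates the diagonal block from the part
  below.\<close>

lemma block_col:
  assumes k: "k < N"
  shows "L * P k = D k + T (Suc k) * L * P k"
proof -
  have "L * P k = (L * T k) * P k" by (simp add: mult_mat_assoc_dim tail_mult_block_proj)
  also have "\<dots> = T k * (L * P k)"
    using k by (subst lower) (auto simp: mult_mat_assoc_dim tail_mult_block_proj)
  also have "\<dots> = P k * (L * P k) + T (Suc k) * (L * P k)"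
    unfolding T_split[OF k] using L by (intro add_mult_distrib_mat[of _ n n _ _ n]) auto
  finally show ?thesis by (simp add: D_def mult_mat_assoc_dim)
qed

lemma RB: "R * B \<in> carrier_mat n n" "L * (R * B) = 1\<^sub>m n" "R * B * L = 1\<^sub>m n"
proof -
  show 1: "R * B \<in> carrier_mat n n" using R B by auto
  show 2: "L * (R * B) = 1\<^sub>m n" using inv by (simp add: mult_mat_assoc_dim)
  show "R * B * L = 1\<^sub>m n" by (rule mat_mult_left_right_inverse[OF L 1 2])
qed

text \<open>\<open>R * B\<close> is the inverse of \<open>L\<close>, and the claim for
  \<open>i = j\<close> is that it is block lower triangular. The induction removes one leading block
  row at a time: if \<open>?M\<close> lives on the rows from block \<open>i\<close> on and
  \<open>i < j\<close>, then \<open>D i * ?M = P i * L * ?M = P i * T j = 0\<close>.\<close>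

lemma inverse_lower:
  assumes "i \<le> j" and j: "j \<le> N"
  shows "R * B * T j = T i * (R * B * T j)"
  using assms(1)
proof (induction i)
  case 0
  show ?case using left_mult_one_mat[of "R * B * T j" n n] RB(1) by (simp add: c0 tail_proj_zero)
next
  case (Suc i)
  let ?M = "R * B * T j"
  have i: "i < N" using Suc.prems j by simp
  have M: "?M \<in> carrier_mat n n" by (intro closed)
  have IH: "?M = T i * ?M" using Suc by simp
  have "D i * ?M = P i * L * (T i * ?M)"
    using M by (simp add: block_row[OF i, symmetric] mult_mat_assoc_dim)
  also have "\<dots> = P i * (L * (R * B)) * T j"
    unfolding IH[symmetric] by (simp add: mult_mat_assoc_dim)
  also have "\<dots> = 0\<^sub>m n n"
    using Suc.prems c_mono[of "Suc i" j] j
    by (simp add: RB(2) right_mult_one_mat[of _ n n] block_mult_tail_proj)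
  \<comment> \<open>The diagonal block is inverted by its adjoint:
    \<open>mat_adjoint (D i) * D i = P i\<close>.\<close>
  finally have "mat_adjoint (D i) * (D i * ?M) = 0\<^sub>m n n"
    by (simp add: right_mult_zero_mat[of _ n n])
  then have PM: "P i * ?M = 0\<^sub>m n n"
    using M by (simp add: D_gram[OF i, symmetric] mult_mat_assoc_dim)
  have "T i * ?M = P i * ?M + T (Suc i) * ?M"
    unfolding T_split[OF i] using M by (intro add_mult_distrib_mat[of _ n n _ _ n]) auto
  then have "T i * ?M = T (Suc i) * ?M"
    by (simp add: PM left_add_zero_mat[OF mult_carrier_mat[OF tail_proj_carrier M]])
  then show ?case using IH by simp
qed

text \<open>The conjugated projection \<open>?Z = L * T (Suc k) * (R * B)\<close> is applied to
  \<open>L * P k = D k + Y\<close>. It annihilates the left side because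
  \<open>T (Suc k) * P k = 0\<close>, and it fixes \<open>Y\<close> because the inverse of
  \<open>L\<close> also preserves the range of \<open>T (Suc k)\<close>. Hence
  \<open>?Z * D k + Y = 0\<close>.\<close>

lemma sub_diagonal:
  assumes k: "k < N"
  shows "T (Suc k) * L * P k = - (L * T (Suc k) * R * B * D k)"
proof -
  define X where "X = L * T (Suc k) * R * B * D k"
  define Y where "Y = T (Suc k) * L * P k"
  have X: "X \<in> carrier_mat n n" and Y: "Y \<in> carrier_mat n n" unfolding X_def Y_def by (intro closed)+
  let ?Z = "L * T (Suc k) * (R * B)"
  have Z: "?Z \<in> carrier_mat n n" by (intro closed)
  have "?Z * (L * P k) = L * T (Suc k) * (R * B * L) * P k" by (simp add: mult_mat_assoc_dim)
  also have "\<dots> = L * (T (Suc k) * P k)"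
    using L unfolding RB(3) by (subst right_mult_one_mat[of _ n n]) (auto simp: mult_mat_assoc_dim)
  also have "\<dots> = 0\<^sub>m n n"
    using L by (simp add: tail_mult_block_proj_zero right_mult_zero_mat[of _ n n])
  finally have "0\<^sub>m n n = ?Z * (D k + Y)" by (simp only: block_col[OF k, folded Y_def])
  also have "\<dots> = ?Z * D k + ?Z * Y"
    by (rule mult_add_distrib_mat[OF Z D_carrier Y])
  also have "?Z * D k = X" by (simp add: X_def mult_mat_assoc_dim)
  also have "?Z * Y = L * (T (Suc k) * (R * B * T (Suc k))) * (L * P k)"
    by (simp add: Y_def mult_mat_assoc_dim)
  also have "\<dots> = L * (R * B * T (Suc k)) * (L * P k)"
    using inverse_lower[of "Suc k" "Suc k"] k by simp
  also have "\<dots> = (L * (R * B)) * Y" by (simp add: Y_def mult_mat_assoc_dim)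
  also have "\<dots> = Y" using Y by (simp add: RB(2))
  finally have zero: "X + Y = 0\<^sub>m n n" by simp
  have "Y = - X"
  proof (rule eq_matI)
    fix i j assume "i < dim_row (- X)" "j < dim_col (- X)"
    then have ij: "i < n" "j < n" using X by auto
    have "(X + Y) $$ (i, j) = 0" using zero ij by simp
    then show "Y $$ (i, j) = (- X) $$ (i, j)"
      using ij X Y by (simp add: add_eq_0_iff)
  qed (use X Y in auto)
  then show ?thesis by (simp add: X_def Y_def)
qed

text \<open>\<open>G\<close> is a common bound for the Schur complements padded with zeros; later it
  becomes the growth factor times the norm of \<open>A\<close>.\<close>

context
  fixes p :: ereal and G :: real
  assumes p: "1 \<le> p" and G: "\<And>k. k < N \<Longrightarrow> schatten p (L * T k * R) \<le> G"
begin

text \<open>Sums over the block rows \<open>P k * R\<close>, each of which is a contraction times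
  the padded Schur complement \<open>L * T k * R\<close>.\<close>

lemma schatten_R_le: "schatten p R \<le> real N * G"
proof -
  have "schatten p (T 0 * R) \<le> real N * G"
  proof (rule schatten_telescope[OF p, of "\<lambda>k. T k * R" n "\<lambda>k. P k * R"])
    fix k assume k: "k < N"
    show "T k * R = P k * R + T (Suc k) * R"
      unfolding T_split[OF k] using R by (intro add_mult_distrib_mat[of _ n n _ _ n]) auto
    have Ak: "L * T k * R \<in> carrier_mat n n" by (intro closed)
    \<comment> \<open>The left factor recovers the block row, since
      \<open>P k * L * T k = D k\<close> and \<open>mat_adjoint (D k) * D k = P k\<close>. The
      identity on the right fits the two-sided form of
      \<open>schatten_contraction_mult\<close>.\<close>
    have "mat_adjoint (D k) * P k * (L * T k * R) * 1\<^sub>m n = mat_adjoint (D k) * P k * (L * T k * R)"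
      by (intro right_mult_one_mat[of _ n n]) (intro closed)
    also have "\<dots> = mat_adjoint (D k) * (P k * L * T k) * R"
      by (simp add: mult_mat_assoc_dim)
    also have "\<dots> = P k * R"
      unfolding block_row[OF k] D_gram[OF k] ..
    finally have "P k * R = mat_adjoint (D k) * P k * (L * T k * R) * 1\<^sub>m n" ..
    also have "schatten p \<dots> \<le> schatten p (L * T k * R)"
      by (rule schatten_contraction_mult[OF p Ak, of _ n _ n])
        (auto intro!: contraction_mult[of _ n n _ n] contraction_adjoint contraction_D k
          contraction_block_proj simp: dmat_one[symmetric] contraction_dmat)
    finally show "schatten p (P k * R) \<le> G" using G[OF k] by simp
  qed (use R in \<open>auto simp: cN tail_proj_end\<close>)
  then show ?thesis using R by (simp add: c0 tail_proj_zero)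
qed

text \<open>Sums over the block columns \<open>L * P k\<close>. The diagonal block contributes the
  \<open>root_p\<close> term; the part below it is controlled through \<open>sub_diagonal\<close> by
  the next Schur complement and the inverse \<open>B\<close>.\<close>

lemma schatten_L_le:
  assumes nb: "\<And>k. k < N \<Longrightarrow> c (Suc k) - c k \<le> nb"
  shows "schatten p L \<le> real N * (root_p p (real nb) + G * schatten p B)"
proof -
  have "schatten p (L * T 0) \<le> real N * (root_p p (real nb) + G * schatten p B)"
  proof (rule schatten_telescope[OF p, of "\<lambda>k. L * T k" n "\<lambda>k. L * P k"])
    fix k assume k: "k < N"
    show "L * T k = L * P k + L * T (Suc k)"
      unfolding T_split[OF k] using L by (intro mult_add_distrib_mat[of _ n n _ n]) auto
    have "D k = D k * P k * 1\<^sub>m n"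
      using right_mult_one_mat[OF D_carrier[of k]] by (simp add: D_def mult_mat_assoc_dim block_proj_idem)
    also have "schatten p \<dots> \<le> schatten p (P k)"
      by (rule schatten_contraction_mult[OF p, of _ n n _ n _ n])
        (auto intro: contraction_D k simp: dmat_one[symmetric] contraction_dmat)
    also have "\<dots> \<le> root_p p (real (c (Suc k) - c k))"
      using c_less[OF k] c_mono[of "Suc k" N] k by (intro schatten_block_proj p) (auto simp: cN)
    also have "\<dots> \<le> root_p p (real nb)"
      using nb[OF k] by (intro root_p_mono p) auto
    finally have 1: "schatten p (D k) \<le> root_p p (real nb)" .
    let ?S = "L * T (Suc k) * R"
    have S: "?S \<in> carrier_mat n n" by (intro closed)
    \<comment> \<open>The bound \<open>G\<close> is assumed for indices below \<open>N\<close> only.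
      At \<open>Suc k = N\<close> the product is zero, and \<open>G\<close> is nonnegative by the
      assumption at \<open>k\<close>.\<close>
    have SG: "schatten p ?S \<le> G"
    proof (cases "Suc k < N")
      case False
      then have "Suc k = N" using k by simp
      then have "?S = 0\<^sub>m n n" using L R by (simp add: cN tail_proj_end)
      then show ?thesis using G[OF k] schatten_nonneg[of p "L * T k * R"] by (simp add: schatten_zero[OF p])
    qed (rule G)
    have "schatten p (T (Suc k) * L * P k) \<le> schatten p (?S * B * D k)"
      unfolding sub_diagonal[OF k] by (rule schatten_uminus[OF p])
    also have "?S * B * D k = 1\<^sub>m n * (?S * B) * D k" using S B by simp
    also have "schatten p \<dots> \<le> schatten p (?S * B)"
      by (rule schatten_contraction_mult[OF p, of _ n n _ n _ n])
        (use S B in \<open>auto intro: contraction_D k simp: dmat_one[symmetric] contraction_dmat\<close>)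
    also have "\<dots> \<le> schatten p ?S * schatten p B" by (rule schatten_mult[OF p S B])
    also have "\<dots> \<le> G * schatten p B" by (intro mult_right_mono SG schatten_nonneg)
    finally have 2: "schatten p (T (Suc k) * L * P k) \<le> G * schatten p B" .
    have "schatten p (L * P k) \<le> schatten p (D k) + schatten p (T (Suc k) * L * P k)"
      using L by (subst block_col[OF k]) (auto intro!: schatten_add[OF p, of _ n n])
    then show "schatten p (L * P k) \<le> root_p p (real nb) + G * schatten p B"
      using 1 2 by simp
  qed (use L in \<open>auto simp: cN tail_proj_end\<close>)
  then show ?thesis using L by (simp add: c0 tail_proj_zero)
qed

end

end

section \<open>The block LU algorithm\<close>

text \<open>The row selection that translates between blocks and padded matrices: multiplying by it
  on the left and by its adjoint on the right cuts out a block, and the reverse order pads a block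
  with zeros.\<close>

definition sel :: "nat \<Rightarrow> nat \<Rightarrow> nat \<Rightarrow> complex mat" where
  "sel n a b = mat (b - a) n (\<lambda>(i, j). if j = a + i then 1 else 0)"

lemma sel_dim [simp]: "dim_row (sel n a b) = b - a" "dim_col (sel n a b) = n"
  by (simp_all add: sel_def)

lemma sel_carrier [simp, intro]: "sel n a b \<in> carrier_mat (b - a) n"
  by (simp add: sel_def)

lemma sel_mult_index:
  assumes "M \<in> carrier_mat n m" "i < b - a" "b \<le> n" "j < m"
  shows "(sel n a b * M) $$ (i, j) = M $$ (a + i, j)"
  using assms by (subst mult_mat_index[of _ "b - a" n _ m]) (auto simp: sel_def if_distrib[of "\<lambda>x. x * _"] cong: if_cong)

lemma mult_sel_adjoint_index:
  assumes "M \<in> carrier_mat m n" "j < b - a" "b \<le> n" "i < m"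
  shows "(M * mat_adjoint (sel n a b)) $$ (i, j) = M $$ (i, a + j)"
  using assms by (subst mult_mat_index[of _ m n _ "b - a"]) (auto simp: sel_def if_distrib cong: if_cong)

lemma blk_sub_conv_sel:
  assumes M: "M \<in> carrier_mat n n" and "r1 \<le> n" "c1 \<le> n"
  shows "blk_sub M r0 r1 c0 c1 = sel n r0 r1 * M * mat_adjoint (sel n c0 c1)"
proof (rule eq_matI)
  fix i j assume "i < dim_row (sel n r0 r1 * M * mat_adjoint (sel n c0 c1))"
    "j < dim_col (sel n r0 r1 * M * mat_adjoint (sel n c0 c1))"
  then have ij: "i < r1 - r0" "j < c1 - c0" by auto
  have SM: "sel n r0 r1 * M \<in> carrier_mat (r1 - r0) n" using M by (intro mult_carrier_mat[OF sel_carrier])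
  show "blk_sub M r0 r1 c0 c1 $$ (i, j) = (sel n r0 r1 * M * mat_adjoint (sel n c0 c1)) $$ (i, j)"
    using ij assms by (simp add: mult_sel_adjoint_index[OF SM] sel_mult_index[OF M] blk_sub_def)
qed (auto simp: blk_sub_def)

lemma sel_coisometry:
  assumes "b \<le> n"
  shows "sel n a b * mat_adjoint (sel n a b) = 1\<^sub>m (b - a)"
proof (rule eq_matI)
  fix i j assume "i < dim_row (1\<^sub>m (b - a))" "j < dim_col (1\<^sub>m (b - a))"
  then show "(sel n a b * mat_adjoint (sel n a b)) $$ (i, j) = 1\<^sub>m (b - a) $$ (i, j)"
    using assms by (simp add: sel_mult_index[OF adjoint_carrier[OF sel_carrier]]) (auto simp: sel_def)
qed auto

lemma sel_adjoint_mult_sel: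
  assumes "b \<le> n"
  shows "mat_adjoint (sel n a b) * sel n a b = block_proj n a b"
proof (rule eq_matI)
  fix i j assume "i < dim_row (block_proj n a b)" "j < dim_col (block_proj n a b)"
  then have ij: "i < n" "j < n" by auto
  have "(mat_adjoint (sel n a b) * sel n a b) $$ (i, j)
      = (\<Sum>k<b - a. (if i = a + k then 1 else 0) * (if j = a + k then 1 else 0))"
    using ij by (subst mult_mat_index[of _ n "b - a" _ n]) (auto simp: sel_def intro!: sum.cong)
  \<comment> \<open>At most one term survives. The guard \<open>a \<le> i\<close> compensates for
    the truncated subtraction in \<open>i - a\<close>.\<close>
  also have "\<dots> = (\<Sum>k<b - a. if k = i - a then (if a \<le> i \<and> i = j then 1 else 0) else 0)"
    by (intro sum.cong) auto
  also have "\<dots> = block_proj n a b $$ (i, j)"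
    using ij assms by (auto simp: block_proj_def)
  finally show "(mat_adjoint (sel n a b) * sel n a b) $$ (i, j) = block_proj n a b $$ (i, j)" .
qed auto

lemma contraction_sel: "b \<le> n \<Longrightarrow> contraction (sel n a b)"
  using contraction_adjoint[OF contraction_isometry[of "mat_adjoint (sel n a b)" n "b - a"]]
  by (simp add: sel_coisometry adjoint_carrier)

lemma block_proj_to_end: "block_proj n a n = tail_proj n a"
  by (auto simp: block_proj_def tail_proj_def intro: dmat_cong)

text \<open>Under \<open>supp\<close>, \<open>M\<close> is its own trailing block padded with zeros,
  that is, the block between two contractions.\<close>

lemma schatten_le_trailing_block:
  assumes p: "1 \<le> p" and M: "M \<in> carrier_mat n n"
    and supp: "tail_proj n a * M * tail_proj n a = M"
  shows "schatten p M \<le> schatten p (blk_sub M a n a n)"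
proof -
  let ?E = "sel n a n"
  have T: "tail_proj n a = mat_adjoint ?E * ?E"
    by (simp add: sel_adjoint_mult_sel block_proj_to_end)
  have "M = mat_adjoint ?E * blk_sub M a n a n * ?E"
    by (subst supp[symmetric]) (use M in \<open>simp add: T blk_sub_conv_sel mult_mat_assoc_dim\<close>)
  also have "schatten p \<dots> \<le> schatten p (blk_sub M a n a n)"
    by (rule schatten_contraction_mult[OF p, of _ "n - a" "n - a" _ n _ n])
      (auto simp: blk_sub_def intro: contraction_sel contraction_adjoint)
  finally show ?thesis .
qed

lemma block_proj_gram:
  assumes M: "M \<in> carrier_mat n n" and b: "b \<le> n"
    and U: "mat_adjoint (blk_sub M a b a b) * blk_sub M a b a b = 1\<^sub>m (b - a)"
  shows "mat_adjoint (block_proj n a b * M * block_proj n a b) * (block_proj n a b * M * block_proj n a b)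
    = block_proj n a b"
proof -
  let ?E = "sel n a b" and ?U = "blk_sub M a b a b"
  have Uc: "?U \<in> carrier_mat (b - a) (b - a)" by (simp add: blk_sub_def)
  have D: "block_proj n a b * M * block_proj n a b = mat_adjoint ?E * ?U * ?E"
    using M b by (simp add: sel_adjoint_mult_sel[symmetric] blk_sub_conv_sel mult_mat_assoc_dim)
  have "mat_adjoint (mat_adjoint ?E * ?U * ?E) * (mat_adjoint ?E * ?U * ?E)
      = mat_adjoint ?E * (mat_adjoint ?U * (?E * mat_adjoint ?E) * ?U) * ?E"
    using Uc by (simp add: adjoint_mult_dim mult_mat_assoc_dim)
  also have "\<dots> = mat_adjoint ?E * (mat_adjoint ?U * ?U) * ?E"
    unfolding sel_coisometry[OF b] using right_mult_one_mat[OF adjoint_carrier[OF Uc]] by simp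
  also have "\<dots> = mat_adjoint ?E * ?E"
    unfolding U using right_mult_one_mat[OF adjoint_carrier[OF sel_carrier[of n a b]]] by simp
  finally show ?thesis unfolding D sel_adjoint_mult_sel[OF b] .
qed

lemma blk_sub_blk_sub:
  assumes "a \<le> b" "b \<le> n"
  shows "blk_sub (blk_sub M a n a n) (b - a) (n - a) (b - a) (n - a) = blk_sub M b n b n"
  using assms by (intro eq_matI) (auto simp: blk_sub_def)

lemma blk_sub_adjoint:
  fixes M :: "complex mat"
  assumes "M \<in> carrier_mat n n" "b \<le> n"
  shows "blk_sub (mat_adjoint M) a b a b = mat_adjoint (blk_sub M a b a b)"
  using assms by (intro eq_matI) (auto simp: blk_sub_def)

text \<open>Splitting \<open>tail_proj n a\<close> splits \<open>L * tail_proj n a * R\<close> into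
  \<open>L * block_proj n a b * R\<close> and the next such matrix. On the trailing indices, the
  former is the product of the block column of \<open>L\<close> with the block row of
  \<open>R\<close> that the algorithm subtracts.\<close>

lemma schur_complement_step:
  assumes L: "L \<in> carrier_mat n n" and R: "R \<in> carrier_mat n n" and ab: "a \<le> b" "b \<le> n"
    and Ak: "Ak = blk_sub (L * tail_proj n a * R) a n a n"
  shows "blk_sub Ak (b - a) (n - a) (b - a) (n - a) - blk_sub L b n a b * blk_sub R a b b n
      = blk_sub (L * tail_proj n b * R) b n b n"
proof -
  have LT: "L * X * R \<in> carrier_mat n n" if "X \<in> carrier_mat n n" for X
    using that L R by (intro mult_carrier_mat[of _ n n])
  have "L * tail_proj n a * R = (L * block_proj n a b + L * tail_proj n b) * R"
    unfolding tail_proj_split[OF ab(1)] using L by (subst mult_add_distrib_mat[of _ n n _ n]) auto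
  also have "\<dots> = L * block_proj n a b * R + L * tail_proj n b * R"
    using L R by (intro add_mult_distrib_mat[of _ n n _ _ n] mult_carrier_mat[of _ n n]) auto
  finally have split: "L * tail_proj n a * R = L * block_proj n a b * R + L * tail_proj n b * R" .
  have prod: "blk_sub L b n a b * blk_sub R a b b n = blk_sub (L * block_proj n a b * R) b n b n"
    unfolding blk_sub_conv_sel[OF LT[OF block_proj_carrier] order_refl order_refl]
    using L R ab by (simp add: blk_sub_conv_sel[of _ n] sel_adjoint_mult_sel[symmetric] mult_mat_assoc_dim)
  show ?thesis unfolding Ak blk_sub_blk_sub[OF ab] prod unfolding split
    using L R by (intro eq_matI) (auto simp: blk_sub_def)
qed

text \<open>Since \<open>minv\<close> takes \<open>the\<close> of an option, invertibility must
  first be turned into membership in the units of the matrix ring, which ensures that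
  \<open>mat_inverse\<close> returns a value.\<close>

lemma minv_inverse:
  assumes A: "A \<in> carrier_mat n n" and inv: "invertible_mat A"
  shows "minv A \<in> carrier_mat n n" "A * minv A = 1\<^sub>m n" "minv A * A = 1\<^sub>m n"
proof -
  obtain B where AB: "A * B = 1\<^sub>m n" and BA: "B * A = 1\<^sub>m (dim_row B)"
    using inv A by (auto simp: invertible_mat_def inverts_mat_def)
  have "dim_col B = n" using arg_cong[OF AB, of dim_col] by simp
  moreover have "dim_row B = n" using arg_cong[OF BA, of dim_col] A by simp
  ultimately have B: "B \<in> carrier_mat n n" by auto
  have "A \<in> Units (ring_mat TYPE(complex) n ())"
    using A B AB BA by (auto simp: Units_def ring_mat_simps intro!: bexI[of _ B])
  then obtain C where C: "mat_inverse A = Some C"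
    using mat_inverse(1)[OF A, where b="()"] by (cases "mat_inverse A") auto
  from mat_inverse(2)[OF A C] show "minv A \<in> carrier_mat n n" "A * minv A = 1\<^sub>m n" "minv A * A = 1\<^sub>m n"
    by (auto simp: minv_def C)
qed

section \<open>Blockings and block triangularity\<close>

lemma valid_blocking_less:
  assumes "valid_blocking I n" "k < l" "l \<le> nblocks I"
  shows "I ! k < I ! l"
  using assms by (auto simp: valid_blocking_def intro: sorted_wrt_nth_less)

lemma valid_blocking_le:
  assumes "valid_blocking I n" "k \<le> l" "l \<le> nblocks I"
  shows "I ! k \<le> I ! l"
  using valid_blocking_less[OF assms(1), of k l] assms by (cases "k = l") auto

lemma block_of_index:
  assumes I: "valid_blocking I n" and i: "i < n"
  obtains k where "k < nblocks I" "I ! k \<le> i" "i < I ! Suc k"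
proof -
  define k where "k = (LEAST k. i < I ! Suc k)"
  have N: "nblocks I \<noteq> 0" "I ! 0 = 0" "I ! nblocks I = n"
    using I i by (auto simp: valid_blocking_def)
  from N(1) have "Suc (nblocks I - 1) = nblocks I" by linarith
  then have last: "i < I ! Suc (nblocks I - 1)" by (simp only: N(3) i)
  have k1: "i < I ! Suc k" unfolding k_def by (rule LeastI[where P="\<lambda>k. i < I ! Suc k", OF last])
  have "k \<le> nblocks I - 1" unfolding k_def by (rule Least_le[where P="\<lambda>k. i < I ! Suc k", OF last])
  then have k2: "k < nblocks I" using N by simp
  have "I ! k \<le> i"
  proof (cases k)
    case (Suc k')
    then have "\<not> i < I ! Suc k'" using not_less_Least[of k' "\<lambda>k. i < I ! Suc k"] by (simp add: k_def)
    then show ?thesis using Suc by simp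
  qed (use N in simp)
  with k1 k2 show ?thesis by (rule that[rotated -1])
qed

text \<open>Reduces an entry on the two sides of a block boundary to a pair of distinct blocks, so
  that blockwise triangularity gives zeros entrywise.\<close>

lemma block_index_less:
  assumes I: "valid_blocking I n" and k: "k \<le> nblocks I" and ij: "i < I ! k" "I ! k \<le> j" "j < n"
  obtains k' l where "k' < nblocks I" "l < nblocks I" "k' < l" "I ! k' \<le> i" "i < I ! Suc k'" "I ! l \<le> j" "j < I ! Suc l"
proof -
  have "i < n" using ij by simp
  from block_of_index[OF I this] obtain k' where k': "k' < nblocks I" "I ! k' \<le> i" "i < I ! Suc k'" .
  from block_of_index[OF I ij(3)] obtain l where l: "l < nblocks I" "I ! l \<le> j" "j < I ! Suc l" .
  have "k' < k" using valid_blocking_le[OF I, of k k'] k' ij by (intro ccontr[of "k' < k"]) auto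
  then have "I ! Suc k' \<le> I ! k" using valid_blocking_le[OF I, of "Suc k'" k] k by simp
  then have "k' < l" using valid_blocking_le[OF I, of "Suc l" "Suc k'"] k' l ij
    by (intro ccontr[of "k' < l"]) auto
  with k' l show ?thesis by (intro that)
qed

lemma block_lower_zero:
  assumes "valid_blocking I n" "block_lower I L" "k \<le> nblocks I" "i < I ! k" "I ! k \<le> j" "j < n"
  shows "L $$ (i, j) = 0"
  by (rule block_index_less[OF assms(1,3-6)]) (use assms(2) in \<open>unfold block_lower_def, blast\<close>)

lemma block_upper_zero:
  assumes "valid_blocking I n" "block_upper I R" "k \<le> nblocks I" "j < I ! k" "I ! k \<le> i" "i < n"
  shows "R $$ (i, j) = 0"
  by (rule block_index_less[OF assms(1,3-6)]) (use assms(2) in \<open>unfold block_upper_def, blast\<close>)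

lemma tail_proj_invariant:
  assumes L: "L \<in> carrier_mat n n" and zero: "\<And>i j. i < a \<Longrightarrow> a \<le> j \<Longrightarrow> j < n \<Longrightarrow> L $$ (i, j) = 0"
  shows "L * tail_proj n a = tail_proj n a * L * tail_proj n a"
  using L zero by (intro eq_matI) (auto simp: tail_proj_def)

lemma adjoint_tail_proj_invariant:
  assumes R: "R \<in> carrier_mat n n"
    and "mat_adjoint R * tail_proj n a = tail_proj n a * mat_adjoint R * tail_proj n a"
  shows "tail_proj n a * R = tail_proj n a * R * tail_proj n a"
proof -
  have "tail_proj n a * R = mat_adjoint (mat_adjoint R * tail_proj n a)"
    using R by (simp add: adjoint_mult_dim adjoint_tail_proj)
  also have "\<dots> = tail_proj n a * R * tail_proj n a"
    unfolding assms(2) using R by (simp add: adjoint_mult_dim adjoint_tail_proj mult_mat_assoc_dim)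
  finally show ?thesis .
qed

lemma product_bound:
  fixes x y r N g ka s :: real
  assumes "x \<le> r * N + N * g * ka" "y \<le> N * g * s" "0 \<le> x" "0 \<le> y"
  shows "x * y \<le> N\<^sup>2 * g\<^sup>2 * ka * s + r * N\<^sup>2 * g * s"
proof -
  have "x * y \<le> (r * N + N * g * ka) * (N * g * s)"
    using assms by (intro mult_mono) auto
  then show ?thesis by (simp add: power2_eq_square algebra_simps)
qed

theorem theorem2p6:
  fixes A L R :: "complex mat" and Ak :: "nat \<Rightarrow> complex mat"
    and I :: "nat list" and n :: nat and p :: ereal
  assumes "A \<in> carrier_mat n n"
    and "invertible_mat A"
    and "valid_blocking I n"
    and "block_strongly_nonsingular I A"
    and "block_lu_run I A Ak L R"
    and "A = L * R"
    and "1 \<le> p"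
  shows "((\<forall>k < nblocks I. unitary_mat (block I L k k)) \<longrightarrow>
           schatten p L \<le> root_p p (max_block_size I) * nblocks I
                            + nblocks I * growth p I A Ak * kappa p A \<and>
           schatten p R \<le> nblocks I * growth p I A Ak * schatten p A \<and>
           schatten p L * schatten p R \<le>
             (nblocks I)\<^sup>2 * (growth p I A Ak)\<^sup>2 * kappa p A * schatten p A
             + root_p p (max_block_size I) * (nblocks I)\<^sup>2 * growth p I A Ak * schatten p A)
       \<and> ((\<forall>k < nblocks I. unitary_mat (block I R k k)) \<longrightarrow>
           schatten p R \<le> root_p p (max_block_size I) * nblocks I
                            + nblocks I * growth p I A Ak * kappa p A \<and>
           schatten p L \<le> nblocks I * growth p I A Ak * schatten p A \<and>
           schatten p L * schatten p R \<le>
             (nblocks I)\<^sup>2 * (growth p I A Ak)\<^sup>2 * kappa p A * schatten p A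
             + root_p p (max_block_size I) * (nblocks I)\<^sup>2 * growth p I A Ak * schatten p A)"
proof -
  note A = assms(1) and I = assms(3) and ALR = assms(6) and p = assms(7)
  let ?N = "nblocks I" and ?c = "\<lambda>k. I ! k"
  have run: "L \<in> carrier_mat n n" "R \<in> carrier_mat n n" "block_lower I L" "block_upper I R" "Ak 0 = A"
    and schur: "\<And>k. k < ?N \<Longrightarrow> Ak (Suc k) =
      blk_sub (Ak k) (?c (Suc k) - ?c k) (n - ?c k) (?c (Suc k) - ?c k) (n - ?c k)
      - blk_sub L (?c (Suc k)) n (?c k) (?c (Suc k)) * blk_sub R (?c k) (?c (Suc k)) (?c (Suc k)) n"
    using assms(5) A unfolding block_lu_run_def Let_def by auto
  note L = run(1) and R = run(2)
  have c0: "?c 0 = 0" and cN: "?c ?N = n" using I by (auto simp: valid_blocking_def)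
  have cn: "?c k \<le> n" if "k \<le> ?N" for k using valid_blocking_le[OF I that] cN by simp
  let ?T = "\<lambda>k. tail_proj n (?c k)"
  have lowerL: "L * ?T k = ?T k * L * ?T k" if "k \<le> ?N" for k
    by (rule tail_proj_invariant[OF L block_lower_zero[OF I run(3) that]])
  have lowerR: "mat_adjoint R * ?T k = ?T k * mat_adjoint R * ?T k" if k: "k \<le> ?N" for k
  proof (rule tail_proj_invariant[OF adjoint_carrier[OF R]])
    fix i j assume "i < ?c k" "?c k \<le> j" "j < n"
    then show "mat_adjoint R $$ (i, j) = 0"
      using block_upper_zero[OF I run(4) k] R by simp
  qed
  have upperR: "?T k * R = ?T k * R * ?T k" if "k \<le> ?N" for k
    by (rule adjoint_tail_proj_invariant[OF R lowerR[OF that]])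
  \<comment> \<open>The matrices produced by the algorithm are the trailing blocks of
    \<open>L * ?T k * R\<close>, by induction along the Schur complement recursion.\<close>
  have Ak: "Ak k = blk_sub (L * ?T k * R) (?c k) n (?c k) n" if "k \<le> ?N" for k
    using that
  proof (induction k)
    case 0
    show ?case using A run(5) L R
      by (intro eq_matI) (auto simp: ALR c0 tail_proj_zero blk_sub_def)
  next
    case (Suc k)
    then show ?case
      using schur_complement_step[OF L R, of "?c k" "?c (Suc k)" "Ak k"] cn[of "Suc k"] valid_blocking_le[OF I, of k "Suc k"] schur[of k]
      by simp
  qed
  \<comment> \<open>\<open>L * ?T k * R\<close> vanishes outside the trailing block: triangularity
    of \<open>L\<close> confines its rows, that of \<open>R\<close> its columns.\<close>
  have M_le: "schatten p (L * ?T k * R) \<le> schatten p (Ak k)" if k: "k \<le> ?N" for k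
    unfolding Ak[OF k]
  proof (rule schatten_le_trailing_block[OF p])
    show "L * ?T k * R \<in> carrier_mat n n" using L R by (intro mult_carrier_mat[of _ n n] tail_proj_carrier)
    have "?T k * (L * ?T k * R) * ?T k = (?T k * L * ?T k) * (R * ?T k)"
      using L R by (simp add: mult_mat_assoc_dim)
    also have "\<dots> = L * (?T k * R * ?T k)"
      unfolding lowerL[OF k, symmetric] using L R by (simp add: mult_mat_assoc_dim)
    also have "\<dots> = L * ?T k * R"
      unfolding upperR[OF k, symmetric] using L R by (simp add: mult_mat_assoc_dim)
    finally show "?T k * (L * ?T k * R) * ?T k = L * ?T k * R" .
  qed
  let ?B = "minv A"
  note B = minv_inverse[OF A assms(2)]
  \<comment> \<open>Multiplying by the norm of \<open>A\<close> undoes the normalisation in the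
    growth factor, which requires this norm to be positive.\<close>
  define G where "G = growth p I A Ak * schatten p A"
  have G: "schatten p (L * ?T k * R) \<le> G" if k: "k < ?N" for k
  proof -
    have n: "0 < n" using valid_blocking_less[OF I, of 0 ?N] k c0 cN by simp
    \<comment> \<open>A zero \<open>A\<close> would make the identity zero, although
      \<open>n\<close> is positive because a block exists.\<close>
    have "\<exists>i<n. \<exists>j<n. A $$ (i, j) \<noteq> 0"
    proof (rule ccontr)
      assume "\<not> ?thesis"
      then have "A = 0\<^sub>m n n" using A by (intro eq_matI) auto
      then have "1\<^sub>m n = (0\<^sub>m n n :: complex mat)" using B by simp
      from arg_cong[OF this, of "\<lambda>M. M $$ (0, 0)"] n show False by simp
    qed
    then have pos: "0 < schatten p A" using schatten_pos[OF p A] by blast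
    have "schatten p (Ak k) / schatten p A \<le> growth p I A Ak"
      unfolding growth_def using k by (intro Max_ge) auto
    then have "schatten p (Ak k) \<le> G" using pos by (simp add: G_def field_simps)
    then show ?thesis using M_le[of k] k by simp
  qed
  have nb: "?c (Suc k) - ?c k \<le> max_block_size I" if "k < ?N" for k
    unfolding max_block_size_def using that by (intro Max_ge) auto
  have case1: "schatten p L \<le> root_p p (max_block_size I) * ?N + ?N * growth p I A Ak * kappa p A \<and>
      schatten p R \<le> ?N * growth p I A Ak * schatten p A"
    if U: "\<forall>k < ?N. unitary_mat (block I L k k)"
  proof -
    interpret unitary_block_lu n ?N ?c L R ?B
    proof
      fix k assume k: "k < ?N"
      show "?c k < ?c (Suc k)" using valid_blocking_less[OF I, of k "Suc k"] k by simp
      have "mat_adjoint (block I L k k) * block I L k k = 1\<^sub>m (?c (Suc k) - ?c k)"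
        using U k by (auto simp: unitary_mat_def block_def blk_sub_def)
      then show "mat_adjoint (block_proj n (?c k) (?c (Suc k)) * L * block_proj n (?c k) (?c (Suc k)))
        * (block_proj n (?c k) (?c (Suc k)) * L * block_proj n (?c k) (?c (Suc k))) = block_proj n (?c k) (?c (Suc k))"
        using k by (intro block_proj_gram[OF L cn]) (auto simp: block_def)
    qed (use L R B c0 cN lowerL ALR in auto)
    show ?thesis
      using schatten_R_le[OF p G] schatten_L_le[OF p G nb]
      by (simp add: G_def kappa_def algebra_simps)
  qed
  have case2: "schatten p R \<le> root_p p (max_block_size I) * ?N + ?N * growth p I A Ak * kappa p A \<and>
      schatten p L \<le> ?N * growth p I A Ak * schatten p A"
    if U: "\<forall>k < ?N. unitary_mat (block I R k k)"
  proof -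
    \<comment> \<open>The adjoint of \<open>A\<close> factors as
      \<open>mat_adjoint R * mat_adjoint L\<close>, whose first factor is block lower triangular
      with unitary diagonal blocks. The Schur complements become adjoints of the former ones, so the
      same \<open>G\<close> bounds them.\<close>
    interpret unitary_block_lu n ?N ?c "mat_adjoint R" "mat_adjoint L" "mat_adjoint ?B"
    proof
      fix k assume k: "k < ?N"
      show "?c k < ?c (Suc k)" using valid_blocking_less[OF I, of k "Suc k"] k by simp
      \<comment> \<open>The other half of unitarity is needed here, since this product is the Gram
        matrix of the adjoint block.\<close>
      have "block I R k k * mat_adjoint (block I R k k) = 1\<^sub>m (?c (Suc k) - ?c k)"
        using U k by (auto simp: unitary_mat_def block_def blk_sub_def)
      then show "mat_adjoint (block_proj n (?c k) (?c (Suc k)) * mat_adjoint R * block_proj n (?c k) (?c (Suc k)))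
        * (block_proj n (?c k) (?c (Suc k)) * mat_adjoint R * block_proj n (?c k) (?c (Suc k))) = block_proj n (?c k) (?c (Suc k))"
        using k cn[of "Suc k"] by (intro block_proj_gram[OF adjoint_carrier[OF R]])
          (auto simp: block_def blk_sub_adjoint[OF R])
    next
      have "mat_adjoint R * mat_adjoint L * mat_adjoint ?B = mat_adjoint (?B * (L * R))"
        using L R B(1) by (simp add: adjoint_mult_dim mult_mat_assoc_dim)
      also have "\<dots> = 1\<^sub>m n"
        unfolding ALR[symmetric] B(3) dmat_one[symmetric] adjoint_dmat by simp
      finally show "mat_adjoint R * mat_adjoint L * mat_adjoint ?B = 1\<^sub>m n" .
    qed (use L R B c0 cN lowerR in auto)
    have G': "schatten p (mat_adjoint R * ?T k * mat_adjoint L) \<le> G" if "k < ?N" for k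
    proof -
      have "mat_adjoint R * ?T k * mat_adjoint L = mat_adjoint (L * ?T k * R)"
        using run(1,2) by (simp add: adjoint_mult_dim mult_mat_assoc_dim adjoint_tail_proj)
      then show ?thesis using G[OF that] by (simp only: schatten_adjoint[OF p])
    qed
    show ?thesis
      using schatten_R_le[OF p G'] schatten_L_le[OF p G' nb]
      by (simp add: G_def kappa_def algebra_simps schatten_adjoint[OF p])
  qed
  show ?thesis
  proof (intro conjI impI)
    assume U: "\<forall>k < ?N. unitary_mat (block I L k k)"
    show "schatten p L \<le> root_p p (max_block_size I) * ?N + ?N * growth p I A Ak * kappa p A"
      "schatten p R \<le> ?N * growth p I A Ak * schatten p A"
      using case1[OF U] by auto
    then show "schatten p L * schatten p R \<le> (?N)\<^sup>2 * (growth p I A Ak)\<^sup>2 * kappa p A * schatten p A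
        + root_p p (max_block_size I) * (?N)\<^sup>2 * growth p I A Ak * schatten p A"
      unfolding of_nat_power by (intro product_bound schatten_nonneg)
  next
    assume U: "\<forall>k < ?N. unitary_mat (block I R k k)"
    show "schatten p R \<le> root_p p (max_block_size I) * ?N + ?N * growth p I A Ak * kappa p A"
      "schatten p L \<le> ?N * growth p I A Ak * schatten p A"
      using case2[OF U] by auto
    then show "schatten p L * schatten p R \<le> (?N)\<^sup>2 * (growth p I A Ak)\<^sup>2 * kappa p A * schatten p A
        + root_p p (max_block_size I) * (?N)\<^sup>2 * growth p I A Ak * schatten p A"
      unfolding of_nat_power mult.commute[of "schatten p L"] by (intro product_bound schatten_nonneg)
  qed
qed

end
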